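(* Let $\langle x,y,a\rangle\in\mathcal S_1$. The following statements are equivalent. (i) $\langle x,y,a\rangle\in\mathfrak H_2$; (ii) $\langle x,y,a\rangle\in\mathfrak H_\infty$; (iii) $y\le\sqrt{\dfrac{1-x^2}{1-a^2}}$.
   Context: Given bounded families of positive numbers $\alpha_{\mathbf k},\beta_{\mathbf k}$ ($\mathbf k\in\mathbb Z_+^2$), the $2$-variable weighted shift $W_{(\alpha,\beta)}\equiv(T_1,T_2)$ on $\ell^2(\mathbb Z_+^2)$ with canonical orthonormal basis $\{e_{\mathbf k}\}$ is $T_1e_{\mathbf k}:=\alpha_{\mathbf k}e_{\mathbf k+(1,0)}$, $T_2e_{\mathbf k}:=\beta_{\mathbf k}e_{\mathbf k+(0,1)}$. An $n$-tuple $(S_1,\dots,S_n)$ of Hilbert space operators is (jointly) hyponormal if the operator matrix with $(i,j)$ entry $[S_j^*,S_i]=S_j^*S_i-S_iS_j^*$ is positive. A commuting pair $(T_1,T_2)$ is $2$-hyponormal if $(T_1,T_2,T_1^2,T_2T_1,T_2^2)$ is hyponormal. A pair is subnormal if it is the restriction of a commuting pair of normal operators to a common invariant subspace. $\mathfrak H_0$ is the set of commuting pairs of subnormal operators; $\mathfrak H_1$, $\mathfrak H_2$ are the sets of hyponormal, respectively $2$-hyponormal, pairs in $\mathfrak H_0$; $\mathfrak H_\infty$ is the set of subnormal pairs. For $0<x,y,a\le1$ with $ay\le x$, $\langle x,y,a\rangle$ denotes the $2$-variable weighted shift with weights $\alpha_{(0,0)}=x$; $\alpha_{(i,0)}=1$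 ($i\ge1$); $\alpha_{(0,j)}=a$ ($j\ge1$); $\alpha_{(i,j)}=1$ ($i,j\ge1$); $\beta_{(0,0)}=y$; $\beta_{(i,0)}=\frac{ay}{x}$ ($i\ge1$); $\beta_{(i,j)}=1$ ($i\ge0$, $j\ge1$). The notation $\langle x,y,a\rangle\in\mathcal S_1$ means that in addition this shift belongs to $\mathfrak H_1$. When $a=1$, condition (iii) is read as $y^2(1-a^2)\le 1-x^2$ (which then holds automatically). *)

theory Defs
  imports "HOL-Analysis.Analysis" "HOL-Library.Infinite_Typeclass"
begin

section \<open>The complex Hilbert space of square-summable families\<close>

lemma ell2_add_closed:
  fixes f g :: "'i \<Rightarrow> complex"
  assumes "(\<lambda>i. (cmod (f i))\<^sup>2) summable_on UNIV" "(\<lambda>i. (cmod (g i))\<^sup>2) summable_on UNIV"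
  shows "(\<lambda>i. (cmod (f i + g i))\<^sup>2) summable_on UNIV"
proof (rule summable_on_comparison_test)
  show "(\<lambda>i. 2 * (cmod (f i))\<^sup>2 + 2 * (cmod (g i))\<^sup>2) summable_on UNIV"
    by (intro summable_on_add summable_on_cmult_right assms)
next
  fix i
  have "(cmod (f i + g i))\<^sup>2 \<le> (cmod (f i) + cmod (g i))\<^sup>2"
    by (intro power_mono norm_triangle_ineq) auto
  also have "\<dots> \<le> 2 * (cmod (f i))\<^sup>2 + 2 * (cmod (g i))\<^sup>2"
    using zero_le_power2[of "cmod (f i) - cmod (g i)"]
    by (simp add: power2_eq_square algebra_simps)
  finally show "(cmod (f i + g i))\<^sup>2 \<le> 2 * (cmod (f i))\<^sup>2 + 2 * (cmod (g i))\<^sup>2" .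
qed auto

typedef 'i ell2 = "{f :: 'i \<Rightarrow> complex. (\<lambda>i. (cmod (f i))\<^sup>2) summable_on UNIV}"
  morphisms ell2_apply Abs_ell2
  by (rule exI[of _ "\<lambda>_. 0"]) simp

setup_lifting type_definition_ell2

lemma ell2_eqI: "(\<And>i. ell2_apply x i = ell2_apply y i) \<Longrightarrow> x = y"
  by (metis ell2_apply_inject ext)

lemma ell2_summable: "(\<lambda>i. (cmod (ell2_apply x i))\<^sup>2) summable_on UNIV"
  using ell2_apply[of x] by simp

lift_definition scaleC :: "complex \<Rightarrow> 'i ell2 \<Rightarrow> 'i ell2"  (infixr \<open>*\<^sub>C\<close> 75)
  is "\<lambda>c f i. c * f i"
  by (simp add: norm_mult power_mult_distrib summable_on_cmult_right)

(* Linear in the first argument, conjugate-linear in the second. *)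
definition cinner :: "'i ell2 \<Rightarrow> 'i ell2 \<Rightarrow> complex" where
  "cinner x y = (\<Sum>\<^sub>\<infinity>i. ell2_apply x i * cnj (ell2_apply y i))"

lemma cinner_summable: "(\<lambda>i. ell2_apply x i * cnj (ell2_apply y i)) summable_on UNIV"
  by (rule abs_summable_summable, rule abs_summable_product)
     (use ell2_summable[of x] ell2_summable[of y] in \<open>simp_all add: norm_mult power2_eq_square\<close>)

lemma cinner_self: "cinner x x = of_real (\<Sum>\<^sub>\<infinity>i. (cmod (ell2_apply x i))\<^sup>2)"
proof -
  have "((\<lambda>i. complex_of_real ((cmod (ell2_apply x i))\<^sup>2)) has_sum
      of_real (\<Sum>\<^sub>\<infinity>i. (cmod (ell2_apply x i))\<^sup>2)) UNIV"
    by (intro has_sum_of_real has_sum_infsum ell2_summable)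
  then show ?thesis
    unfolding cinner_def complex_norm_square by (rule infsumI)
qed

instantiation ell2 :: (type) real_vector
begin

lift_definition zero_ell2 :: "'a ell2" is "\<lambda>_. 0" by simp
lift_definition plus_ell2 :: "'a ell2 \<Rightarrow> 'a ell2 \<Rightarrow> 'a ell2" is "\<lambda>f g i. f i + g i"
  by (rule ell2_add_closed)
lift_definition uminus_ell2 :: "'a ell2 \<Rightarrow> 'a ell2" is "\<lambda>f i. - f i" by simp
definition minus_ell2 :: "'a ell2 \<Rightarrow> 'a ell2 \<Rightarrow> 'a ell2" where "minus_ell2 x y = x + - y"
definition scaleR_ell2 :: "real \<Rightarrow> 'a ell2 \<Rightarrow> 'a ell2" where "scaleR_ell2 r x = complex_of_real r *\<^sub>C x"

instance
proof
  fix x y z :: "'a ell2" and r s :: real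
  show "x + y + z = x + (y + z)" by transfer (simp add: add.assoc)
  show "x + y = y + x" by transfer (simp add: add.commute)
  show "0 + x = x" by transfer simp
  show "- x + x = 0" by transfer simp
  show "x - y = x + - y" by (rule minus_ell2_def)
  show "r *\<^sub>R (x + y) = r *\<^sub>R x + r *\<^sub>R y"
    unfolding scaleR_ell2_def by transfer (simp add: algebra_simps)
  show "(r + s) *\<^sub>R x = r *\<^sub>R x + s *\<^sub>R x"
    unfolding scaleR_ell2_def by transfer (simp add: algebra_simps)
  show "r *\<^sub>R s *\<^sub>R x = (r * s) *\<^sub>R x"
    unfolding scaleR_ell2_def by transfer (simp add: algebra_simps)
  show "1 *\<^sub>R x = x"
    unfolding scaleR_ell2_def by transfer simp
qed

end

lemma cinner_commute: "cinner y x = cnj (cinner x y)"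
  unfolding cinner_def infsum_cnj[symmetric] by (simp add: mult.commute)

lemma cinner_add_left: "cinner (x + y) z = cinner x z + cinner y z"
  unfolding cinner_def by (simp add: plus_ell2.rep_eq distrib_right infsum_add cinner_summable)

lemma cinner_scaleC_left: "cinner (c *\<^sub>C x) y = c * cinner x y"
  unfolding cinner_def
  by (simp add: scaleC.rep_eq mult.assoc infsum_cmult_right cinner_summable)

instantiation ell2 :: (type) real_inner
begin

definition inner_ell2 :: "'a ell2 \<Rightarrow> 'a ell2 \<Rightarrow> real" where "inner_ell2 x y = Re (cinner x y)"
definition norm_ell2 :: "'a ell2 \<Rightarrow> real" where "norm_ell2 x = sqrt (inner x x)"
definition dist_ell2 :: "'a ell2 \<Rightarrow> 'a ell2 \<Rightarrow> real" where "dist_ell2 x y = norm (x - y)"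
definition sgn_ell2 :: "'a ell2 \<Rightarrow> 'a ell2" where "sgn_ell2 x = x /\<^sub>R norm x"
definition uniformity_ell2 :: "('a ell2 \<times> 'a ell2) filter" where
  "uniformity_ell2 = (INF e\<in>{0 <..}. principal {(x, y). dist x y < e})"
definition open_ell2 :: "'a ell2 set \<Rightarrow> bool" where
  "open_ell2 U = (\<forall>x\<in>U. eventually (\<lambda>(x', y). x' = x \<longrightarrow> y \<in> U) uniformity)"

instance
proof
  fix x y z :: "'a ell2" and r s :: real
  show "dist x y = norm (x - y)" by (rule dist_ell2_def)
  show "sgn x = x /\<^sub>R norm x" by (rule sgn_ell2_def)
  show "(uniformity :: ('a ell2 \<times> 'a ell2) filter) = (INF e\<in>{0 <..}. principal {(x, y). dist x y < e})"
    by (rule uniformity_ell2_def)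
  show "open U = (\<forall>x\<in>U. eventually (\<lambda>(x', y). x' = x \<longrightarrow> y \<in> U) uniformity)" for U :: "'a ell2 set"
    by (rule open_ell2_def)
  show "inner x y = inner y x"
    by (simp add: inner_ell2_def cinner_commute[of x y])
  show "inner (x + y) z = inner x z + inner y z"
    by (simp add: inner_ell2_def cinner_add_left)
  show "inner (r *\<^sub>R x) y = r * inner x y"
    by (simp add: inner_ell2_def scaleR_ell2_def cinner_scaleC_left)
  show "0 \<le> inner x x"
    unfolding inner_ell2_def cinner_self by (simp add: infsum_nonneg)
  show "inner x x = 0 \<longleftrightarrow> x = 0"
  proof
    assume "inner x x = 0"
    then have "(\<Sum>\<^sub>\<infinity>i. (cmod (ell2_apply x i))\<^sup>2) \<le> 0"
      unfolding inner_ell2_def cinner_self by simp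
    then have "(cmod (ell2_apply x i))\<^sup>2 = 0" for i
      by (rule nonneg_infsum_le_0D) (auto intro: ell2_summable)
    then show "x = 0"
      by (intro ell2_eqI) (simp add: zero_ell2.rep_eq)
  next
    assume "x = 0"
    then show "inner x x = 0"
      by (simp add: inner_ell2_def cinner_def zero_ell2.rep_eq)
  qed
  show "norm x = sqrt (inner x x)" by (rule norm_ell2_def)
qed

end

lemma norm_ell2_square: "(norm x)\<^sup>2 = (\<Sum>\<^sub>\<infinity>i. (cmod (ell2_apply x i))\<^sup>2)" for x :: "'i ell2"
  by (simp add: power2_norm_eq_inner inner_ell2_def cinner_self)

lift_definition basis_vec :: "'i \<Rightarrow> 'i ell2" is "\<lambda>k i. if i = k then 1 else 0"
proof -
  fix k :: 'i
  have "(\<lambda>i. (cmod (if i = k then 1 else 0))\<^sup>2) summable_on {k}" by simp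
  then show "(\<lambda>i. (cmod (if i = k then 1 else 0))\<^sup>2) summable_on UNIV"
    by (rule summable_on_cong_neutral[THEN iffD1, rotated -1]) auto
qed


section \<open>Bounded operators\<close>

definition bounded_op :: "('i ell2 \<Rightarrow> 'j ell2) \<Rightarrow> bool" where
  "bounded_op A \<longleftrightarrow> bounded_linear A \<and> (\<forall>c x. A (c *\<^sub>C x) = c *\<^sub>C A x)"

(* The Hilbert space adjoint; meant for bounded operators only, for which it exists and is unique. *)
definition adj :: "('i ell2 \<Rightarrow> 'j ell2) \<Rightarrow> 'j ell2 \<Rightarrow> 'i ell2" where
  "adj A = (THE B. \<forall>x y. cinner (A x) y = cinner x (B y))"

lemma bounded_op_adj_exists:
  fixes A :: "'i ell2 \<Rightarrow> 'j ell2"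
  assumes A: "bounded_op A"
  shows "\<exists>!B. \<forall>x y. cinner (A x) y = cinner x (B y)"
proof -
  have cadd: "cinner z (x + y) = cinner z x + cinner z y" for x y z :: "'n ell2"
    by (metis cinner_commute cinner_add_left complex_cnj_add)
  have CS: "cmod (cinner x y) \<le> norm x * norm y" for x y :: "'n ell2"
  proof (cases "cinner x y = 0")
    case False
    define c where "c = cnj (sgn (cinner x y))"
    have [simp]: "cmod c = 1" using False by (simp add: c_def norm_sgn)
    have "c * cinner x y = cmod (cinner x y)"
      using False complex_norm_square[of "cinner x y"]
      by (simp add: c_def sgn_eq field_simps power2_eq_square)
    then have "cmod (cinner x y) = inner (c *\<^sub>C x) y"
      by (simp add: inner_ell2_def cinner_scaleC_left)
    also have "\<dots> \<le> norm (c *\<^sub>C x) * norm y" by (rule norm_cauchy_schwarz)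
    also have "norm (c *\<^sub>C x) = norm x"
    proof -
      have "(norm (c *\<^sub>C x))\<^sup>2 = (norm x)\<^sup>2"
        by (simp add: norm_ell2_square scaleC.rep_eq norm_mult)
      then show ?thesis by simp
    qed
    finally show ?thesis .
  qed simp
  have A_lin: "bounded_linear A" and A_scale: "A (c *\<^sub>C x) = c *\<^sub>C A x" for c x
    using A by (auto simp: bounded_op_def)
  have apply_sum: "ell2_apply (\<Sum>i\<in>F. c i *\<^sub>C basis_vec i) k = (if k \<in> F then c k else 0)"
    if "finite F" for F :: "'i set" and c k
    using that by (induction F) (auto simp: zero_ell2.rep_eq plus_ell2.rep_eq scaleC.rep_eq basis_vec.rep_eq)
  define b where "b y i = cinner (A (basis_vec i)) y" for y i
  have lin: "bounded_linear (\<lambda>x. cinner (A x) y)" for y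
  proof -
    obtain K where K: "norm (A x) \<le> norm x * K" for x
      using bounded_linear.bounded[OF A_lin] by auto
    show ?thesis
    proof (rule bounded_linear_intro)
      fix x z and r :: real
      show "cinner (A (x + z)) y = cinner (A x) y + cinner (A z) y"
        by (simp add: linear_add[OF bounded_linear.linear[OF A_lin]] cinner_add_left)
      show "cinner (A (r *\<^sub>R x)) y = r *\<^sub>R cinner (A x) y"
        by (simp add: scaleR_ell2_def A_scale cinner_scaleC_left scaleR_conv_of_real)
      have "cmod (cinner (A x) y) \<le> norm (A x) * norm y" by (rule CS)
      also have "\<dots> \<le> norm x * K * norm y"
        by (intro mult_right_mono K) auto
      finally show "norm (cinner (A x) y) \<le> norm x * (K * norm y)" by (simp add: mult_ac)
    qed
  qed
  have fin: "cinner (A (\<Sum>i\<in>F. c i *\<^sub>C basis_vec i)) y = (\<Sum>i\<in>F. c i * b y i)" for F c y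
    using linear_sum[OF bounded_linear.linear[OF lin[of y]], of "\<lambda>i. c i *\<^sub>C basis_vec i" F]
    by (simp add: A_scale cinner_scaleC_left b_def)
  have b_summable: "(\<lambda>i. (cmod (cnj (b y i)))\<^sup>2) summable_on UNIV" for y
  proof -
    obtain K where K: "cmod (cinner (A x) y) \<le> norm x * K" for x
      using bounded_linear.bounded[OF lin[of y]] by auto
    have "(\<Sum>i\<in>F. (cmod (b y i))\<^sup>2) \<le> K\<^sup>2" if F: "finite F" for F
    proof -
      define s where "s = (\<Sum>i\<in>F. (cmod (b y i))\<^sup>2)"
      define x where "x = (\<Sum>i\<in>F. cnj (b y i) *\<^sub>C basis_vec i)"
      have s0: "s \<ge> 0" by (simp add: s_def sum_nonneg)
      have "(norm x)\<^sup>2 = (\<Sum>\<^sub>\<infinity>i. if i \<in> F then (cmod (b y i))\<^sup>2 else 0)"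
        unfolding norm_ell2_square x_def apply_sum[OF F] by (intro infsum_cong) auto
      also have "\<dots> = (\<Sum>\<^sub>\<infinity>i\<in>F. (cmod (b y i))\<^sup>2)"
        by (rule infsum_cong_neutral) auto
      finally have nx: "(norm x)\<^sup>2 = s" using F by (simp add: s_def)
      have "cinner (A x) y = of_real s"
        unfolding x_def fin s_def of_real_sum
        by (intro sum.cong refl) (metis complex_norm_square mult.commute)
      then have "s \<le> norm x * K" using K[of x] s0 by simp
      then have "norm x * norm x \<le> norm x * K" using nx by (simp add: power2_eq_square)
      then have "norm x \<le> K \<or> norm x = 0" by (auto simp: mult_le_cancel_left)
      then have "(norm x)\<^sup>2 \<le> K\<^sup>2" by (auto intro: power_mono)
      then show ?thesis using nx s_def by simp
    qed
    then show ?thesis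
      by (intro nonneg_bdd_above_summable_on bdd_aboveI[of _ "K\<^sup>2"]) auto
  qed
  define B where "B y = Abs_ell2 (\<lambda>i. cnj (b y i))" for y
  have B_apply: "ell2_apply (B y) i = cnj (b y i)" for y i
    unfolding B_def by (subst Abs_ell2_inverse) (use b_summable in auto)
  have expand: "((\<lambda>i. ell2_apply x i *\<^sub>C basis_vec i) has_sum x) UNIV" for x :: "'i ell2"
    unfolding has_sum_def
  proof (rule tendstoI)
    fix e :: real assume e: "e > 0"
    let ?q = "\<lambda>i. (cmod (ell2_apply x i))\<^sup>2"
    from e have e2: "e\<^sup>2 > 0" by simp
    have "(?q has_sum infsum ?q UNIV) UNIV" using ell2_summable by (rule has_sum_infsum)
    then have "\<forall>\<^sub>F Y in finite_subsets_at_top UNIV. dist (sum ?q Y) (infsum ?q UNIV) < e\<^sup>2"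
      unfolding has_sum_def using e2 by (rule tendstoD)
    then obtain X where X: "finite X" and
      XY: "\<And>Y. finite Y \<Longrightarrow> X \<subseteq> Y \<Longrightarrow> dist (sum ?q Y) (infsum ?q UNIV) < e\<^sup>2"
      unfolding eventually_finite_subsets_at_top by auto
    have "dist (\<Sum>i\<in>Y. ell2_apply x i *\<^sub>C basis_vec i) x < e" if Y: "finite Y" "X \<subseteq> Y" for Y
    proof -
      have "(dist (\<Sum>i\<in>Y. ell2_apply x i *\<^sub>C basis_vec i) x)\<^sup>2 =
          (\<Sum>\<^sub>\<infinity>i. (cmod ((if i \<in> Y then ell2_apply x i else 0) - ell2_apply x i))\<^sup>2)"
        unfolding dist_norm norm_ell2_square minus_ell2_def plus_ell2.rep_eq apply_sum[OF Y(1)]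
          uminus_ell2.rep_eq by simp
      also have "\<dots> = infsum ?q (- Y)"
        by (rule infsum_cong_neutral) auto
      also have "\<dots> = infsum ?q UNIV - sum ?q Y"
        using infsum_Un_disjoint[of ?q Y "- Y"] Y(1)
          summable_on_subset_banach[OF ell2_summable[of x] subset_UNIV, of "- Y"] by simp
      also have "\<dots> < e\<^sup>2" using XY[OF Y] by (simp add: dist_real_def)
      finally show ?thesis using e by (simp add: power_less_imp_less_base)
    qed
    with X show "\<forall>\<^sub>F Y in finite_subsets_at_top UNIV.
        dist (\<Sum>i\<in>Y. ell2_apply x i *\<^sub>C basis_vec i) x < e"
      unfolding eventually_finite_subsets_at_top by (intro exI[of _ X]) auto
  qed
  have main: "cinner (A x) y = cinner x (B y)" for x y
  proof -
    have "((\<lambda>i. cinner (A (ell2_apply x i *\<^sub>C basis_vec i)) y) has_sum cinner (A x) y) UNIV"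
      by (rule has_sum_bounded_linear[OF lin expand, unfolded o_def])
    then show ?thesis
      unfolding cinner_def[of x "B y"] B_apply
      by (simp add: A_scale cinner_scaleC_left b_def infsumI)
  qed
  show ?thesis
  proof (rule ex1I[of _ B])
    show "\<forall>x y. cinner (A x) y = cinner x (B y)" using main by blast
  next
    fix C assume C: "\<forall>x y. cinner (A x) y = cinner x (C y)"
    show "C = B"
    proof
      fix y
      have "cinner (C y - B y) (C y) = cinner (C y - B y) (B y)"
        using C main by metis
      moreover have "cinner (C y - B y) (C y) =
          cinner (C y - B y) (C y - B y) + cinner (C y - B y) (B y)"
        by (simp flip: cadd)
      ultimately have "inner (C y - B y) (C y - B y) = 0" by (simp add: inner_ell2_def)
      then show "C y = B y" by simp
    qed
  qed
qed

lemma cinner_adj: "bounded_op A \<Longrightarrow> cinner (A x) y = cinner x (adj A y)"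
  unfolding adj_def using theI'[OF bounded_op_adj_exists, of A] by blast

definition normal_op :: "('i ell2 \<Rightarrow> 'i ell2) \<Rightarrow> bool" where
  "normal_op N \<longleftrightarrow> bounded_op N \<and> adj N \<circ> N = N \<circ> adj N"

(* commutator A B = [A, B] *)
definition commutator :: "('i ell2 \<Rightarrow> 'i ell2) \<Rightarrow> ('i ell2 \<Rightarrow> 'i ell2) \<Rightarrow> 'i ell2 \<Rightarrow> 'i ell2" where
  "commutator A B x = A (B x) - B (A x)"

(* Positivity of the n-by-n operator matrix (M i j) acting on the n-fold direct sum: the vector
   (h 0, ..., h (n-1)) is mapped to the one with i-th entry (\<Sum>j<n. M i j (h j)). *)
definition positive_op_matrix :: "nat \<Rightarrow> (nat \<Rightarrow> nat \<Rightarrow> 'i ell2 \<Rightarrow> 'i ell2) \<Rightarrow> bool" where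
  "positive_op_matrix n M \<longleftrightarrow>
     (\<forall>h :: nat \<Rightarrow> 'i ell2. (\<Sum>i<n. cinner (\<Sum>j<n. M i j (h j)) (h i)) \<in> \<real>\<^sub>\<ge>\<^sub>0)"

definition hyponormal :: "('i ell2 \<Rightarrow> 'i ell2) list \<Rightarrow> bool" where
  "hyponormal S \<longleftrightarrow>
     positive_op_matrix (length S) (\<lambda>i j. commutator (adj (S ! j)) (S ! i))"

definition isometric_embedding :: "('i ell2 \<Rightarrow> 'j ell2) \<Rightarrow> bool" where
  "isometric_embedding V \<longleftrightarrow> bounded_op V \<and> (\<forall>x y. cinner (V x) (V y) = cinner x y)"

(* A tuple is subnormal if it is, up to the unitary identification V of its space with a common
   invariant subspace (the range of V), the restriction of a commuting tuple of normal operators.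
   HOL cannot quantify over the type of the larger Hilbert space, so the latter is
   \<open>'k ell2\<close> for an infinite index type \<open>'k\<close> given as a parameter; every infinite-dimensional
   Hilbert space is of this form up to unitary equivalence. On a separable space
   (\<open>'i\<close> countable) every such \<open>'k\<close> yields the same notion, since a minimal normal extension is
   separable and can be enlarged by a zero summand. *)
definition subnormal :: "'k::infinite itself \<Rightarrow> ('i::countable ell2 \<Rightarrow> 'i ell2) list \<Rightarrow> bool" where
  "subnormal (_ :: 'k itself) T \<longleftrightarrow>
     (\<exists>(V :: 'i ell2 \<Rightarrow> 'k ell2) (N :: ('k ell2 \<Rightarrow> 'k ell2) list).
        isometric_embedding V \<and> length N = length T \<and>
        (\<forall>i<length T. normal_op (N ! i)) \<and>
        (\<forall>i<length T. \<forall>j<length T. N ! i \<circ> N ! j = N ! j \<circ> N ! i) \<and>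
        (\<forall>i<length T. N ! i \<circ> V = V \<circ> T ! i))"


section \<open>The classes of commuting pairs\<close>

type_synonym 'i op_pair = "('i ell2 \<Rightarrow> 'i ell2) \<times> ('i ell2 \<Rightarrow> 'i ell2)"

definition HH0 :: "'k::infinite itself \<Rightarrow> 'i::countable op_pair set" where
  "HH0 K = {(T1, T2). bounded_op T1 \<and> bounded_op T2 \<and> T1 \<circ> T2 = T2 \<circ> T1 \<and>
                      subnormal K [T1] \<and> subnormal K [T2]}"

definition HH1 :: "'k::infinite itself \<Rightarrow> 'i::countable op_pair set" where
  "HH1 K = {(T1, T2) \<in> HH0 K. hyponormal [T1, T2]}"

definition HH2 :: "'k::infinite itself \<Rightarrow> 'i::countable op_pair set" where
  "HH2 K = {(T1, T2) \<in> HH0 K. hyponormal [T1, T2, T1 \<circ> T1, T2 \<circ> T1, T2 \<circ> T2]}"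

definition HHinf :: "'k::infinite itself \<Rightarrow> 'i::countable op_pair set" where
  "HHinf K = {(T1, T2). bounded_op T1 \<and> bounded_op T2 \<and> subnormal K [T1, T2]}"


section \<open>Two-variable weighted shifts\<close>

(* Coordinate form of e_k \<mapsto> \<alpha>_k e_(k + (1,0)) and e_k \<mapsto> \<beta>_k e_(k + (0,1));
   see \<open>shift1_basis_vec\<close>, \<open>bounded_op_shift1\<close> and their analogues.
   Meaningful for bounded weights only. *)
definition shift1 :: "(nat \<times> nat \<Rightarrow> real) \<Rightarrow> (nat \<times> nat) ell2 \<Rightarrow> (nat \<times> nat) ell2" where
  "shift1 \<alpha> f = Abs_ell2 (\<lambda>(i, j).
     if i = 0 then 0 else of_real (\<alpha> (i - 1, j)) * ell2_apply f (i - 1, j))"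

definition shift2 :: "(nat \<times> nat \<Rightarrow> real) \<Rightarrow> (nat \<times> nat) ell2 \<Rightarrow> (nat \<times> nat) ell2" where
  "shift2 \<beta> f = Abs_ell2 (\<lambda>(i, j).
     if j = 0 then 0 else of_real (\<beta> (i, j - 1)) * ell2_apply f (i, j - 1))"

lemma ell2_reindex_bounded:
  fixes w :: "'i \<Rightarrow> real" and g :: "'j \<Rightarrow> complex"
  assumes \<sigma>: "inj \<sigma>" and w: "\<And>k. \<bar>w k\<bar> \<le> C"
    and g: "\<And>k. g (\<sigma> k) = of_real (w k) * ell2_apply f k" and g0: "\<And>m. m \<notin> range \<sigma> \<Longrightarrow> g m = 0"
  shows "(\<lambda>m. (cmod (g m))\<^sup>2) summable_on UNIV"
    and "(\<Sum>\<^sub>\<infinity>m. (cmod (g m))\<^sup>2) \<le> (C * norm f)\<^sup>2"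
proof -
  have le: "(cmod (g (\<sigma> k)))\<^sup>2 \<le> C\<^sup>2 * (cmod (ell2_apply f k))\<^sup>2" for k
    using w[of k] by (auto simp: g norm_mult power_mult_distrib abs_le_square_iff[symmetric]
        intro!: mult_right_mono)
  have C: "(\<lambda>k. C\<^sup>2 * (cmod (ell2_apply f k))\<^sup>2) summable_on UNIV"
    by (intro summable_on_cmult_right ell2_summable)
  have s: "(\<lambda>k. (cmod (g (\<sigma> k)))\<^sup>2) summable_on UNIV"
    by (rule summable_on_comparison_test[OF C]) (use le in auto)
  then have "(\<lambda>m. (cmod (g m))\<^sup>2) summable_on range \<sigma>"
    by (simp add: summable_on_reindex[OF \<sigma>] o_def)
  then show "(\<lambda>m. (cmod (g m))\<^sup>2) summable_on UNIV"
    by (rule summable_on_cong_neutral[THEN iffD1, rotated -1]) (use g0 in auto)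
  have "(\<Sum>\<^sub>\<infinity>m. (cmod (g m))\<^sup>2) = (\<Sum>\<^sub>\<infinity>m\<in>range \<sigma>. (cmod (g m))\<^sup>2)"
    by (rule infsum_cong_neutral) (use g0 in auto)
  also have "\<dots> = (\<Sum>\<^sub>\<infinity>k. (cmod (g (\<sigma> k)))\<^sup>2)"
    by (simp add: infsum_reindex[OF \<sigma>] o_def)
  also have "\<dots> \<le> (\<Sum>\<^sub>\<infinity>k. C\<^sup>2 * (cmod (ell2_apply f k))\<^sup>2)"
    by (rule infsum_mono[OF s C]) (rule le)
  also have "\<dots> = (C * norm f)\<^sup>2"
    by (simp add: norm_ell2_square power_mult_distrib infsum_cmult_right')
  finally show "(\<Sum>\<^sub>\<infinity>m. (cmod (g m))\<^sup>2) \<le> (C * norm f)\<^sup>2" .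
qed

lemma ell2_apply_shift1:
  assumes "\<And>k. \<bar>\<alpha> k\<bar> \<le> C"
  shows "ell2_apply (shift1 \<alpha> f) (i, j) =
    (if i = 0 then 0 else of_real (\<alpha> (i - 1, j)) * ell2_apply f (i - 1, j))"
  unfolding shift1_def
  by (subst Abs_ell2_inverse)
     (auto intro!: ell2_reindex_bounded(1)[where \<sigma> = "\<lambda>(i, j). (Suc i, j)" and w = \<alpha> and C = C and f = f]
        simp: assms inj_on_def image_iff gr0_conv_Suc)

lemma ell2_apply_shift2:
  assumes "\<And>k. \<bar>\<beta> k\<bar> \<le> C"
  shows "ell2_apply (shift2 \<beta> f) (i, j) =
    (if j = 0 then 0 else of_real (\<beta> (i, j - 1)) * ell2_apply f (i, j - 1))"
  unfolding shift2_def
  by (subst Abs_ell2_inverse)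
     (auto intro!: ell2_reindex_bounded(1)[where \<sigma> = "\<lambda>(i, j). (i, Suc j)" and w = \<beta> and C = C and f = f]
        simp: assms inj_on_def image_iff gr0_conv_Suc)

lemma shift1_basis_vec:
  assumes "\<And>k. \<bar>\<alpha> k\<bar> \<le> C"
  shows "shift1 \<alpha> (basis_vec (i, j)) = \<alpha> (i, j) *\<^sub>R basis_vec (i + 1, j)"
proof (rule ell2_eqI)
  fix k
  show "ell2_apply (shift1 \<alpha> (basis_vec (i, j))) k =
      ell2_apply (\<alpha> (i, j) *\<^sub>R basis_vec (i + 1, j)) k"
    by (cases k)
       (auto simp: ell2_apply_shift1[OF assms] scaleR_ell2_def scaleC.rep_eq basis_vec.rep_eq)
qed

lemma shift2_basis_vec:
  assumes "\<And>k. \<bar>\<beta> k\<bar> \<le> C"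
  shows "shift2 \<beta> (basis_vec (i, j)) = \<beta> (i, j) *\<^sub>R basis_vec (i, j + 1)"
proof (rule ell2_eqI)
  fix k
  show "ell2_apply (shift2 \<beta> (basis_vec (i, j))) k =
      ell2_apply (\<beta> (i, j) *\<^sub>R basis_vec (i, j + 1)) k"
    by (cases k)
       (auto simp: ell2_apply_shift2[OF assms] scaleR_ell2_def scaleC.rep_eq basis_vec.rep_eq)
qed

lemma bounded_op_shift1:
  assumes \<alpha>: "\<And>k. \<bar>\<alpha> k\<bar> \<le> C"
  shows "bounded_op (shift1 \<alpha>)"
proof -
  have C: "0 \<le> C" using \<alpha>[of undefined] by linarith
  have "(norm (shift1 \<alpha> f))\<^sup>2 \<le> (C * norm f)\<^sup>2" for f
    unfolding norm_ell2_square[of "shift1 \<alpha> f"]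
    by (rule ell2_reindex_bounded(2)[where \<sigma> = "\<lambda>(i, j). (Suc i, j)" and w = \<alpha>])
       (auto simp: \<alpha> ell2_apply_shift1[OF \<alpha>] inj_on_def image_iff gr0_conv_Suc)
  then have "norm (shift1 \<alpha> f) \<le> norm f * C" for f
    using C by (simp add: power2_le_iff_abs_le mult.commute)
  moreover have "shift1 \<alpha> (f + g) = shift1 \<alpha> f + shift1 \<alpha> g" "shift1 \<alpha> (c *\<^sub>C f) = c *\<^sub>C shift1 \<alpha> f" for f g c
    by (auto intro!: ell2_eqI simp: ell2_apply_shift1[OF \<alpha>] plus_ell2.rep_eq scaleC.rep_eq algebra_simps)
  ultimately show ?thesis
    unfolding bounded_op_def by (auto intro!: bounded_linear_intro simp: scaleR_ell2_def)
qed

lemma bounded_op_shift2: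
  assumes \<beta>: "\<And>k. \<bar>\<beta> k\<bar> \<le> C"
  shows "bounded_op (shift2 \<beta>)"
proof -
  have C: "0 \<le> C" using \<beta>[of undefined] by linarith
  have "(norm (shift2 \<beta> f))\<^sup>2 \<le> (C * norm f)\<^sup>2" for f
    unfolding norm_ell2_square[of "shift2 \<beta> f"]
    by (rule ell2_reindex_bounded(2)[where \<sigma> = "\<lambda>(i, j). (i, Suc j)" and w = \<beta>])
       (auto simp: \<beta> ell2_apply_shift2[OF \<beta>] inj_on_def image_iff gr0_conv_Suc)
  then have "norm (shift2 \<beta> f) \<le> norm f * C" for f
    using C by (simp add: power2_le_iff_abs_le mult.commute)
  moreover have "shift2 \<beta> (f + g) = shift2 \<beta> f + shift2 \<beta> g" "shift2 \<beta> (c *\<^sub>C f) = c *\<^sub>C shift2 \<beta> f" for f g c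
    by (auto intro!: ell2_eqI simp: ell2_apply_shift2[OF \<beta>] plus_ell2.rep_eq scaleC.rep_eq algebra_simps)
  ultimately show ?thesis
    unfolding bounded_op_def by (auto intro!: bounded_linear_intro simp: scaleR_ell2_def)
qed

definition weighted_shift ::
    "(nat \<times> nat \<Rightarrow> real) \<Rightarrow> (nat \<times> nat \<Rightarrow> real) \<Rightarrow> (nat \<times> nat) op_pair" where
  "weighted_shift \<alpha> \<beta> = (shift1 \<alpha>, shift2 \<beta>)"

definition alpha_xya :: "real \<Rightarrow> real \<Rightarrow> nat \<times> nat \<Rightarrow> real" where
  "alpha_xya x a = (\<lambda>(i, j). if i = 0 then (if j = 0 then x else a) else 1)"

definition beta_xya :: "real \<Rightarrow> real \<Rightarrow> real \<Rightarrow> nat \<times> nat \<Rightarrow> real" where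
  "beta_xya x y a = (\<lambda>(i, j). if j = 0 then (if i = 0 then y else a * y / x) else 1)"

definition shift_xya :: "real \<Rightarrow> real \<Rightarrow> real \<Rightarrow> (nat \<times> nat) op_pair" where
  "shift_xya x y a = weighted_shift (alpha_xya x a) (beta_xya x y a)"

end

(* The moments of <x,y,a> are those of the signed measure on {0,1}^2 with masses a^2 y^2,
   x^2 - a^2 y^2, y^2 - a^2 y^2 and p = 1 - x^2 - y^2 + a^2 y^2, and (iii) says that p >= 0.
   If p >= 0, the functions z1^i z2^j on the corresponding tori give a commuting normal extension,
   in which each operator even commutes with the adjoint of the other; this yields subnormality, and
   positivity of the 2-hyponormality matrix by compression.
   Conversely, testing 2-hyponormality on the coefficients of (1 - s)(1 - t) gives p >= 0, and for a
   subnormal pair the same number is obtained from the kernel components of the normal extension. *)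
theory Submission
  imports Defs
begin

section \<open>Rules for the inner product and for bounded operators\<close>

lemma cinner_add_right: "cinner x (y + z) = cinner x y + cinner x z"
  by (metis cinner_commute cinner_add_left complex_cnj_add)

lemma cinner_scaleC_right: "cinner x (c *\<^sub>C y) = cnj c * cinner x y"
  by (metis cinner_commute cinner_scaleC_left complex_cnj_mult)

lemma cinner_zero_left [simp]: "cinner 0 x = 0"
  by (simp add: cinner_def zero_ell2.rep_eq)

lemma cinner_zero_right [simp]: "cinner x 0 = 0"
  by (simp add: cinner_def zero_ell2.rep_eq)

lemma cinner_diff_left: "cinner (x - y) z = cinner x z - cinner y z"
  by (metis cinner_add_left diff_add_cancel eq_diff_eq)

lemma cinner_scaleR_left: "cinner (r *\<^sub>R x) y = of_real r * cinner x y"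
  by (simp add: scaleR_ell2_def cinner_scaleC_left)

lemma cinner_scaleR_right: "cinner x (r *\<^sub>R y) = of_real r * cinner x y"
  by (simp add: scaleR_ell2_def cinner_scaleC_right)

lemma cinner_sum_left: "cinner (\<Sum>i\<in>I. f i) y = (\<Sum>i\<in>I. cinner (f i) y)"
  by (induction I rule: infinite_finite_induct) (auto simp: cinner_add_left)

lemma cinner_sum_right: "cinner y (\<Sum>i\<in>I. f i) = (\<Sum>i\<in>I. cinner y (f i))"
  by (induction I rule: infinite_finite_induct) (auto simp: cinner_add_right)

lemma cinner_self_norm: "cinner x x = of_real ((norm x)\<^sup>2)"
  by (simp add: cinner_self norm_ell2_square)

lemma Re_cinner_le: "Re (cinner x y) \<le> norm x * norm y"
  using norm_cauchy_schwarz[of x y] by (simp add: inner_ell2_def)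

lemma norm_diff_square: "(norm (x - y))\<^sup>2 = (norm x)\<^sup>2 - 2 * Re (cinner x y) + (norm y)\<^sup>2"
  for x y :: "'i ell2"
  by (simp add: power2_norm_eq_inner inner_diff_left inner_diff_right inner_commute)
     (simp add: inner_ell2_def)

lemma cinner_basis_vec: "cinner (basis_vec k) (basis_vec l) = (if k = l then 1 else 0)"
proof -
  have "cinner (basis_vec k) (basis_vec l) = (\<Sum>\<^sub>\<infinity>i\<in>{k}. if k = l then 1 else 0)"
    unfolding cinner_def by (rule infsum_cong_neutral) (auto simp: basis_vec.rep_eq)
  then show ?thesis by simp
qed

lemma norm_basis_vec [simp]: "norm (basis_vec k) = 1"
  by (simp add: norm_ell2_def inner_ell2_def cinner_basis_vec)

lemma cinner_adj_left: "bounded_op A \<Longrightarrow> cinner (adj A x) y = cinner x (A y)"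
  by (metis cinner_adj cinner_commute)

lemma adj_eqI:
  assumes "bounded_op A" "\<And>x y. cinner (A x) y = cinner x (B y)"
  shows "adj A = B"
  using bounded_op_adj_exists[OF assms(1)] cinner_adj[OF assms(1)] assms(2) by metis

lemma bounded_op_diff: "bounded_op A \<Longrightarrow> A (x - y) = A x - A y"
  unfolding bounded_op_def using bounded_linear.linear linear_diff by blast

lemma bounded_op_scaleR: "bounded_op A \<Longrightarrow> A (r *\<^sub>R x) = r *\<^sub>R A x"
  by (simp add: bounded_op_def scaleR_ell2_def)

lemma bounded_op_comp: "bounded_op A \<Longrightarrow> bounded_op B \<Longrightarrow> bounded_op (A \<circ> B)"
  unfolding bounded_op_def o_def by (auto intro: bounded_linear_compose)

lemma bounded_op_sum:
  assumes "\<And>i. i \<in> I \<Longrightarrow> bounded_op (A i)"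
  shows "bounded_op (\<lambda>x. \<Sum>i\<in>I. A i x)"
proof -
  have scale: "c *\<^sub>C (\<Sum>i\<in>I. f i) = (\<Sum>i\<in>I. c *\<^sub>C f i)" for c and f :: "'a \<Rightarrow> 'n ell2"
  proof (induction I rule: infinite_finite_induct)
    case (insert i F)
    have "c *\<^sub>C (u + v) = c *\<^sub>C u + c *\<^sub>C v" for u v :: "'n ell2"
      by transfer (simp add: algebra_simps)
    with insert show ?case by simp
  qed (transfer; simp)+
  from assms show ?thesis
    unfolding bounded_op_def by (auto intro!: bounded_linear_sum simp: scale)
qed

lemma sum_infsum_swap:
  fixes f :: "'a \<Rightarrow> 'b \<Rightarrow> 'c::{topological_comm_monoid_add, t2_space}"
  assumes "\<And>i. i \<in> I \<Longrightarrow> f i summable_on A"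
  shows "(\<Sum>i\<in>I. infsum (f i) A) = (\<Sum>\<^sub>\<infinity>k\<in>A. \<Sum>i\<in>I. f i k)"
proof -
  have "((\<lambda>k. \<Sum>i\<in>I. f i k) has_sum (\<Sum>i\<in>I. infsum (f i) A)) A"
    using assms by (induction I rule: infinite_finite_induct) (auto intro: has_sum_add)
  then show ?thesis by (rule infsumI[symmetric])
qed

section \<open>Joint hyponormality as a quadratic form\<close>

text \<open>Moving the adjoints across the inner product splits each commutator entry in two; the
  subtracted terms of the double sum collapse to the squared norm of the single vector of summed
  adjoints.\<close>

lemma hyponormal_iff:
  assumes S: "\<And>i. i < length S \<Longrightarrow> bounded_op (S ! i)"
  shows "hyponormal S \<longleftrightarrow>
    (\<forall>h. (\<Sum>i<length S. \<Sum>j<length S. cinner ((S ! i) (h j)) ((S ! j) (h i)))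
        - cinner (\<Sum>j<length S. adj (S ! j) (h j)) (\<Sum>j<length S. adj (S ! j) (h j)) \<in> \<real>\<^sub>\<ge>\<^sub>0)"
proof -
  have "cinner (commutator (adj (S ! j)) (S ! i) u) v =
      cinner ((S ! i) u) ((S ! j) v) - cinner (adj (S ! j) u) (adj (S ! i) v)"
    if "i < length S" "j < length S" for i j u v
    using that by (simp add: commutator_def cinner_diff_left cinner_adj_left cinner_adj S)
  then have "(\<Sum>i<length S. cinner (\<Sum>j<length S. commutator (adj (S ! j)) (S ! i) (h j)) (h i)) =
      (\<Sum>i<length S. \<Sum>j<length S. cinner ((S ! i) (h j)) ((S ! j) (h i)))
      - (\<Sum>i<length S. \<Sum>j<length S. cinner (adj (S ! j) (h j)) (adj (S ! i) (h i)))" for h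
    unfolding cinner_sum_left sum_subtractf[symmetric] by (intro sum.cong refl) simp
  moreover have "(\<Sum>i<length S. \<Sum>j<length S. cinner (adj (S ! j) (h j)) (adj (S ! i) (h i))) =
      cinner (\<Sum>j<length S. adj (S ! j) (h j)) (\<Sum>j<length S. adj (S ! j) (h j))" for h
    by (simp only: cinner_sum_right cinner_sum_left)
  ultimately show ?thesis
    unfolding hyponormal_def positive_op_matrix_def by simp
qed

text \<open>The identity operator may be adjoined to a hyponormal tuple without losing positivity of
  the form: completing the square in \<open>h\<^sub>0\<close> turns the extra terms into
  \<open>\<parallel>h\<^sub>0 + \<Sum>\<^sub>j S\<^sub>j\<^sup>* h\<^sub>j\<parallel>\<^sup>2\<close>.\<close>

lemma hyponormal_form_nonneg:
  assumes S: "\<And>i. i < length S \<Longrightarrow> bounded_op (S ! i)" and "hyponormal S"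
  shows "0 \<le> (norm h0)\<^sup>2 + 2 * (\<Sum>j<length S. Re (cinner (h j) ((S ! j) h0)))
    + (\<Sum>i<length S. \<Sum>j<length S. Re (cinner ((S ! i) (h j)) ((S ! j) (h i))))"
proof -
  define g where "g = (\<Sum>j<length S. adj (S ! j) (h j))"
  have "(\<Sum>i<length S. \<Sum>j<length S. cinner ((S ! i) (h j)) ((S ! j) (h i)))
      - cinner g g \<in> \<real>\<^sub>\<ge>\<^sub>0"
    using assms(2) hyponormal_iff[OF S] unfolding g_def by blast
  then have 1: "(norm g)\<^sup>2 \<le> (\<Sum>i<length S. \<Sum>j<length S. Re (cinner ((S ! i) (h j)) ((S ! j) (h i))))"
    by (simp add: complex_nonneg_Reals_iff cinner_self_norm Re_sum)
  have "cinner g h0 = (\<Sum>j<length S. cinner (h j) ((S ! j) h0))"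
    unfolding g_def cinner_sum_left by (auto intro!: sum.cong simp: cinner_adj_left S)
  then have "Re (cinner g h0) = (\<Sum>j<length S. Re (cinner (h j) ((S ! j) h0)))"
    by (simp add: Re_sum)
  \<comment> \<open>Cauchy-Schwarz for \<open>- g\<close>, combined below with the nonnegativity of
    the square of \<open>norm g - norm h0\<close>, replaces the expansion of the completed
    square.\<close>
  moreover have "- (norm g * norm h0) \<le> Re (cinner g h0)"
    using Re_cinner_le[of "0 - g" h0] by (simp only: cinner_diff_left) simp
  moreover have "2 * (norm g * norm h0) \<le> (norm g)\<^sup>2 + (norm h0)\<^sup>2"
    using zero_le_power2[of "norm g - norm h0"] by (simp add: power2_eq_square algebra_simps)
  ultimately show ?thesis using 1 by linarith
qed

text \<open>In the larger space each \<open>M j\<close> can be moved across as \<open>A j\<close>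
  and past \<open>M i\<close>, so the double sum becomes the squared norm of \<open>G\<close>. The
  subtracted term is the squared norm of the compression \<open>g\<close> of \<open>G\<close>, which
  cannot be longer than \<open>G\<close>.\<close>

lemma hyponormal_if_doubly_commuting_extension:
  fixes V :: "'i ell2 \<Rightarrow> 'k ell2" and M A :: "nat \<Rightarrow> 'k ell2 \<Rightarrow> 'k ell2"
  assumes V: "isometric_embedding V"
    and S: "\<And>i. i < length S \<Longrightarrow> bounded_op (S ! i)"
    and ext: "\<And>i x. i < length S \<Longrightarrow> M i (V x) = V ((S ! i) x)"
    and A: "\<And>i x y. i < length S \<Longrightarrow> cinner (M i x) y = cinner x (A i y)"
    and comm: "\<And>i j x. i < length S \<Longrightarrow> j < length S \<Longrightarrow> A j (M i x) = M i (A j x)"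
  shows "hyponormal S"
proof (subst hyponormal_iff, erule S, rule allI)
  fix h
  define n where "n = length S"
  define g where "g = (\<Sum>j<n. adj (S ! j) (h j))"
  define G where "G = (\<Sum>j<n. A j (V (h j)))"
  have iso: "cinner (V x) (V y) = cinner x y" for x y
    using V by (simp add: isometric_embedding_def)
  have A': "cinner (A i x) y = cinner x (M i y)" if "i < n" for i x y
    using A that unfolding n_def by (metis cinner_commute)
  have "cinner ((S ! i) (h j)) ((S ! j) (h i)) = cinner (A j (V (h j))) (A i (V (h i)))"
    if "i < n" "j < n" for i j
  proof -
    have "cinner ((S ! i) (h j)) ((S ! j) (h i)) = cinner (M i (V (h j))) (M j (V (h i)))"
      using that by (simp add: ext iso n_def)
    also have "\<dots> = cinner (M i (A j (V (h j)))) (V (h i))"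
      using that comm A' unfolding n_def by metis
    finally show ?thesis using A that by (simp add: n_def)
  qed
  then have sum_G: "(\<Sum>i<n. \<Sum>j<n. cinner ((S ! i) (h j)) ((S ! j) (h i))) = of_real ((norm G)\<^sup>2)"
    unfolding cinner_self_norm[symmetric] G_def cinner_sum_left cinner_sum_right by simp
  \<comment> \<open>This says that \<open>g\<close> is the image of \<open>G\<close> under the
    adjoint of the isometry \<open>V\<close>; taking \<open>z = g\<close> then bounds its
    norm.\<close>
  have "cinner g z = cinner G (V z)" for z
    unfolding g_def G_def cinner_sum_left
    by (intro sum.cong refl) (simp add: cinner_adj_left S A' iso ext n_def)
  then have "cinner g g = cinner G (V g)" .
  moreover have "norm (V g) = norm g"
    by (simp add: norm_ell2_def inner_ell2_def iso)
  ultimately have "(norm g)\<^sup>2 \<le> norm G * norm g"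
    using Re_cinner_le[of G "V g"] by (metis cinner_self_norm Re_complex_of_real)
  then have "norm g \<le> norm G"
    by (cases "norm g = 0") (auto simp: power2_eq_square)
  then have "(norm g)\<^sup>2 \<le> (norm G)\<^sup>2" by (intro power_mono) auto
  then show "(\<Sum>i<length S. \<Sum>j<length S. cinner ((S ! i) (h j)) ((S ! j) (h i)))
        - cinner (\<Sum>j<length S. adj (S ! j) (h j)) (\<Sum>j<length S. adj (S ! j) (h j)) \<in> \<real>\<^sub>\<ge>\<^sub>0"
    using sum_G unfolding n_def[symmetric] g_def[symmetric] cinner_self_norm
    by (simp flip: of_real_diff del: of_real_power)
qed

section \<open>Commuting pairs of normal operators\<close>

context
  fixes N :: "'k ell2 \<Rightarrow> 'k ell2"
  assumes N: "normal_op N"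
begin

lemma normal_op_bounded: "bounded_op N"
  using N by (simp add: normal_op_def)

lemma normal_op_adj_commute: "adj N (N v) = N (adj N v)"
  using N by (simp add: normal_op_def fun_eq_iff)

lemma norm_adj_normal_op: "norm (adj N v) = norm (N v)"
proof -
  have "cinner (adj N v) (adj N v) = cinner (N v) (N v)"
    using normal_op_bounded by (simp add: cinner_adj_left cinner_adj normal_op_adj_commute)
  then show ?thesis by (simp add: norm_ell2_def inner_ell2_def)
qed

text \<open>Cauchy-Schwarz for \<open>v\<close> and \<open>adj N (N v)\<close>; normality allows
  \<open>adj N\<close> to be replaced by \<open>N\<close> under the norm.\<close>

lemma normal_op_norm_logconvex: "(norm (N v))\<^sup>2 \<le> norm v * norm (N (N v))"
proof -
  have "(norm (N v))\<^sup>2 = Re (cinner v (adj N (N v)))"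
    using cinner_adj[OF normal_op_bounded, of v "N v"]
    by (simp add: cinner_self_norm) (metis Re_complex_of_real of_real_power)
  also have "\<dots> \<le> norm v * norm (adj N (N v))" by (rule Re_cinner_le)
  finally show ?thesis by (simp add: norm_adj_normal_op)
qed

text \<open>Expresses the norm of \<open>w - adj N (N w)\<close> through powers of \<open>N\<close>
  alone, whose norms are known on the range of an extension embedding.\<close>

lemma norm_diff_adj_square:
  "(norm (w - adj N (N w)))\<^sup>2 = (norm w)\<^sup>2 - 2 * (norm (N w))\<^sup>2 + (norm (N (N w)))\<^sup>2"
proof -
  have "Re (cinner w (adj N (N w))) = (norm (N w))\<^sup>2"
    using cinner_adj[OF normal_op_bounded, of w "N w"]
    by (simp add: cinner_self_norm) (metis Re_complex_of_real of_real_power)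
  then show ?thesis by (simp add: norm_diff_square norm_adj_normal_op)
qed

text \<open>The preceding identity at \<open>N w\<close> shows that \<open>N w\<close> is fixed by
  \<open>adj N\<close> after \<open>N\<close>, and \<open>N\<close> commutes with both. Thus
  \<open>w\<close> is the sum of the kernel vector \<open>w - adj N (N w)\<close> and the range
  vector \<open>N (adj N w)\<close>.\<close>

lemma normal_op_diff_adj_in_kernel:
  assumes "norm (N (N w)) = norm (N w)" "norm (N (N (N w))) = norm (N w)"
  shows "N (w - adj N (N w)) = 0"
proof -
  have "(norm (N w - adj N (N (N w))))\<^sup>2 = 0"
    unfolding norm_diff_adj_square assms by simp
  then show ?thesis
    by (simp add: bounded_op_diff[OF normal_op_bounded] flip: normal_op_adj_commute)
qed

text \<open>A normal operator and its adjoint have the same kernel.\<close>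

lemma kernel_orthogonal_range:
  assumes "N v = 0"
  shows "cinner v (N z) = 0"
proof -
  have "adj N v = 0" using norm_adj_normal_op[of v] assms by simp
  then show ?thesis by (simp flip: cinner_adj_left[OF normal_op_bounded])
qed

text \<open>The difference of the two kernel vectors also lies in the range, hence is orthogonal to
  itself.\<close>

lemma kernel_component_unique:
  assumes "N v = 0" "N v' = 0" "v + N z = v' + N z'"
  shows "v = v'"
proof -
  have "v - v' = N (z' - z)"
    using assms(3) by (simp add: bounded_op_diff[OF normal_op_bounded] algebra_simps)
  moreover have "N (v - v') = 0"
    by (simp add: bounded_op_diff[OF normal_op_bounded] assms)
  ultimately have "cinner (v - v') (v - v') = 0"
    using kernel_orthogonal_range by metis
  then show ?thesis by (simp add: cinner_self_norm)
qed

end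

text \<open>The right-hand side is formally \<open>\<langle>(1 - N\<^sub>1\<^sup>*N\<^sub>1)(1 - N\<^sub>2\<^sup>*N\<^sub>2)u, u\<rangle>\<close>. Fuglede's theorem is avoided
  since only the kernel component \<open>u\<^sub>0\<close> of \<open>u\<close> with respect to \<open>N\<^sub>1\<close> matters, and the kernel and
  the range of \<open>N\<^sub>1\<close> are orthogonal and both invariant under \<open>N\<^sub>2\<close>.\<close>

lemma commuting_normal_pair_inequality:
  assumes N1: "normal_op N1" and comm: "N1 \<circ> N2 = N2 \<circ> N1"
    and u: "norm (N1 (N1 u)) = norm (N1 u)" "norm (N1 (N1 (N1 u))) = norm (N1 u)"
    and N2u: "norm (N1 (N1 (N2 u))) = norm (N1 (N2 u))" "norm (N1 (N1 (N1 (N2 u)))) = norm (N1 (N2 u))"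
    and N2N2u: "norm (N1 (N1 (N2 (N2 u)))) = norm (N1 (N2 (N2 u)))"
      "norm (N1 (N1 (N1 (N2 (N2 u))))) = norm (N1 (N2 (N2 u)))"
    and N2: "normal_op N2" "norm (N2 (N2 u)) = norm (N2 u)" "norm (N1 (N2 (N2 u))) = norm (N1 (N2 u))"
  shows "0 \<le> (norm u)\<^sup>2 - (norm (N1 u))\<^sup>2 - (norm (N2 u))\<^sup>2 + (norm (N1 (N2 u)))\<^sup>2"
proof -
  have c: "N1 (N2 v) = N2 (N1 v)" for v using comm by (simp add: fun_eq_iff)
  note b2 = normal_op_bounded[OF N2(1)]
  \<comment> \<open>The candidate for the kernel component of \<open>w\<close> with respect to
    \<open>N1\<close>; the remainder \<open>adj N1 (N1 w)\<close> is in the range by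
    normality.\<close>
  define k where "k w = w - adj N1 (N1 w)" for w
  \<comment> \<open>Applying \<open>N2\<close> to the decomposition of \<open>w\<close> keeps the
    kernel part in the kernel and the range part in the range, so uniqueness of the decomposition of
    \<open>N2 w\<close> gives the claim.\<close>
  have N2_k: "N2 (k w) = k (N2 w)" if "N1 (k w) = 0" "N1 (k (N2 w)) = 0" for w
  proof (rule kernel_component_unique[OF N1])
    show "N1 (N2 (k w)) = 0" using that b2 by (simp add: c bounded_op_diff[of N2 0 0, simplified])
    show "N2 (k w) + N1 (N2 (adj N1 w)) = k (N2 w) + N1 (adj N1 (N2 w))"
      using c[of "adj N1 w"] by (simp add: k_def normal_op_adj_commute[OF N1] bounded_op_diff[OF b2])
  qed fact
  have k: "N1 (k u) = 0" "N1 (k (N2 u)) = 0" "N1 (k (N2 (N2 u))) = 0"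
    using u N2u N2N2u unfolding k_def by (auto intro: normal_op_diff_adj_in_kernel[OF N1])
  have eq: "N2 (k u) = k (N2 u)" "N2 (k (N2 u)) = k (N2 (N2 u))"
    using k by (simp_all add: N2_k)
  \<comment> \<open>The common squared norm of \<open>N2 (k u)\<close> and
    \<open>N2 (N2 (k u))\<close>. Once these two norms agree, log-convexity forces \<open>N2\<close>
    not to increase the norm of \<open>k u\<close>.\<close>
  define q where "q = (norm (N2 u))\<^sup>2 - (norm (N1 (N2 u)))\<^sup>2"
  have n: "(norm (k u))\<^sup>2 = (norm u)\<^sup>2 - (norm (N1 u))\<^sup>2" "(norm (N2 (k u)))\<^sup>2 = q"
    "(norm (N2 (N2 (k u))))\<^sup>2 = q"
    unfolding eq unfolding k_def norm_diff_adj_square[OF N1] u N2u N2N2u N2(2,3) q_def by simp_all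
  then have "norm (N2 (N2 (k u))) = norm (N2 (k u))"
    by (metis norm_ge_zero power2_eq_imp_eq)
  then have "norm (N2 (k u)) * norm (N2 (k u)) \<le> norm (k u) * norm (N2 (k u))"
    using normal_op_norm_logconvex[OF N2(1), of "k u"] by (simp add: power2_eq_square)
  then have "norm (N2 (k u)) \<le> norm (k u)"
    by (cases "norm (N2 (k u)) = 0") auto
  then have "q \<le> (norm (k u))\<^sup>2" using n(2) by (metis norm_ge_zero power_mono)
  then show ?thesis unfolding n(1) q_def by linarith
qed


section \<open>Weighted reindexing operators\<close>

text \<open>The operator sending \<open>basis_vec k\<close> to \<open>w k\<close> times
  \<open>basis_vec (\<sigma> k)\<close>, for injective \<open>\<sigma>\<close> and bounded
  \<open>w\<close>. Shifts, translations and the pieces of the isometric embedding all have this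
  form, so intertwining reduces to comparing maps and weights.\<close>

definition wreindex :: "('i \<Rightarrow> 'j) \<Rightarrow> ('i \<Rightarrow> real) \<Rightarrow> 'i ell2 \<Rightarrow> 'j ell2" where
  "wreindex \<sigma> w f = Abs_ell2 (\<lambda>m.
     if m \<in> range \<sigma> then of_real (w (inv \<sigma> m)) * ell2_apply f (inv \<sigma> m) else 0)"

context
  fixes \<sigma> :: "'i \<Rightarrow> 'j" and w :: "'i \<Rightarrow> real" and C :: real
  assumes \<sigma>: "inj \<sigma>" and w: "\<forall>k. \<bar>w k\<bar> \<le> C"
begin

lemma ell2_apply_wreindex':
  "ell2_apply (wreindex \<sigma> w f) m =
     (if m \<in> range \<sigma> then of_real (w (inv \<sigma> m)) * ell2_apply f (inv \<sigma> m) else 0)"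
  unfolding wreindex_def
  by (subst Abs_ell2_inverse)
     (use \<sigma> w in \<open>auto intro!: ell2_reindex_bounded(1)[where \<sigma> = \<sigma> and w = w and C = C and f = f]\<close>)

lemma ell2_apply_wreindex: "ell2_apply (wreindex \<sigma> w f) (\<sigma> k) = of_real (w k) * ell2_apply f k"
  by (simp add: ell2_apply_wreindex' inv_f_f[OF \<sigma>])

lemma ell2_apply_wreindex_outside: "m \<notin> range \<sigma> \<Longrightarrow> ell2_apply (wreindex \<sigma> w f) m = 0"
  by (simp add: ell2_apply_wreindex')

lemma bounded_op_wreindex: "bounded_op (wreindex \<sigma> w)"
proof -
  have C: "0 \<le> C" using spec[OF w, of undefined] by linarith
  have "(norm (wreindex \<sigma> w f))\<^sup>2 \<le> (C * norm f)\<^sup>2" for f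
    unfolding norm_ell2_square[of "wreindex \<sigma> w f"]
    by (rule ell2_reindex_bounded(2)[where \<sigma> = \<sigma> and w = w])
       (simp_all add: \<sigma> w ell2_apply_wreindex ell2_apply_wreindex_outside)
  then have "norm (wreindex \<sigma> w f) \<le> norm f * C" for f
    using C by (simp add: power2_le_iff_abs_le mult.commute)
  moreover have "wreindex \<sigma> w (f + g) = wreindex \<sigma> w f + wreindex \<sigma> w g"
    "wreindex \<sigma> w (c *\<^sub>C f) = c *\<^sub>C wreindex \<sigma> w f" for f g c
    by (auto intro!: ell2_eqI
        simp: ell2_apply_wreindex' plus_ell2.rep_eq scaleC.rep_eq algebra_simps)
  ultimately show ?thesis
    unfolding bounded_op_def by (auto intro!: bounded_linear_intro simp: scaleR_ell2_def)
qed

lemma cinner_wreindex_left: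
  "cinner (wreindex \<sigma> w f) g = (\<Sum>\<^sub>\<infinity>k. of_real (w k) * ell2_apply f k * cnj (ell2_apply g (\<sigma> k)))"
proof -
  have "cinner (wreindex \<sigma> w f) g =
      (\<Sum>\<^sub>\<infinity>m\<in>range \<sigma>. ell2_apply (wreindex \<sigma> w f) m * cnj (ell2_apply g m))"
    unfolding cinner_def by (rule infsum_cong_neutral) (auto simp: ell2_apply_wreindex_outside)
  also have "\<dots> = (\<Sum>\<^sub>\<infinity>k. of_real (w k) * ell2_apply f k * cnj (ell2_apply g (\<sigma> k)))"
    by (simp add: infsum_reindex[OF \<sigma>] o_def ell2_apply_wreindex)
  finally show ?thesis .
qed

end

lemma wreindex_wreindex:
  assumes \<sigma>: "inj \<sigma>" "\<forall>k. \<bar>w k\<bar> \<le> C" and \<tau>: "inj \<tau>" "\<forall>k. \<bar>v k\<bar> \<le> D"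
  shows "wreindex \<sigma> w (wreindex \<tau> v f) = wreindex (\<sigma> \<circ> \<tau>) (\<lambda>k. w (\<tau> k) * v k) f"
proof (rule ell2_eqI)
  fix m
  have inj: "inj (\<sigma> \<circ> \<tau>)" using \<sigma>(1) \<tau>(1) by (rule inj_compose)
  have bd: "\<forall>k. \<bar>w (\<tau> k) * v k\<bar> \<le> C * D"
    unfolding abs_mult using \<sigma>(2) \<tau>(2)
    by (intro allI mult_mono) (auto intro: order_trans[OF abs_ge_zero])
  note apply_comp = ell2_apply_wreindex[OF inj bd, unfolded o_def]
  show "ell2_apply (wreindex \<sigma> w (wreindex \<tau> v f)) m =
      ell2_apply (wreindex (\<sigma> \<circ> \<tau>) (\<lambda>k. w (\<tau> k) * v k) f) m"
  proof (cases "m \<in> range \<sigma>")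
    case True
    then obtain k where k: "m = \<sigma> k" by auto
    show ?thesis
    proof (cases "k \<in> range \<tau>")
      case True
      then obtain l where "k = \<tau> l" by auto
      then show ?thesis
        using k apply_comp[of f l] by (simp add: ell2_apply_wreindex[OF \<sigma>] ell2_apply_wreindex[OF \<tau>] o_def)
    next
      case False
      then have "m \<notin> range (\<sigma> \<circ> \<tau>)" using k \<sigma>(1) by (auto dest: injD)
      then show ?thesis
        using k False
        by (simp add: ell2_apply_wreindex[OF \<sigma>] ell2_apply_wreindex_outside[OF \<tau>]
            ell2_apply_wreindex_outside[OF inj bd])
    qed
  next
    case False
    then have "m \<notin> range (\<sigma> \<circ> \<tau>)" by auto
    with False show ?thesis
      by (simp add: ell2_apply_wreindex_outside[OF \<sigma>] ell2_apply_wreindex_outside[OF inj bd])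
  qed
qed

lemma shift1_eq_wreindex:
  assumes "\<forall>k. \<bar>\<alpha> k\<bar> \<le> C"
  shows "shift1 \<alpha> = wreindex (\<lambda>(i, j). (Suc i, j)) \<alpha>"
proof (rule ext, rule ell2_eqI)
  fix f and k :: "nat \<times> nat"
  have inj: "inj (\<lambda>(i :: nat, j :: nat). (Suc i, j))" by (auto simp: inj_on_def)
  obtain i j where k: "k = (i, j)" by (cases k)
  show "ell2_apply (shift1 \<alpha> f) k = ell2_apply (wreindex (\<lambda>(i, j). (Suc i, j)) \<alpha> f) k"
  proof (cases i)
    case 0
    then have "k \<notin> range (\<lambda>(i, j). (Suc i, j))" using k by auto
    then show ?thesis
      using 0 k by (simp add: ell2_apply_shift1[OF spec[OF assms]] ell2_apply_wreindex_outside[OF inj assms])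
  next
    case (Suc n)
    then show ?thesis
      using k ell2_apply_wreindex[OF inj assms, of f "(n, j)"]
      by (simp add: ell2_apply_shift1[OF spec[OF assms]])
  qed
qed

lemma shift2_eq_wreindex:
  assumes "\<forall>k. \<bar>\<beta> k\<bar> \<le> C"
  shows "shift2 \<beta> = wreindex (\<lambda>(i, j). (i, Suc j)) \<beta>"
proof (rule ext, rule ell2_eqI)
  fix f and k :: "nat \<times> nat"
  have inj: "inj (\<lambda>(i :: nat, j :: nat). (i, Suc j))" by (auto simp: inj_on_def)
  obtain i j where k: "k = (i, j)" by (cases k)
  show "ell2_apply (shift2 \<beta> f) k = ell2_apply (wreindex (\<lambda>(i, j). (i, Suc j)) \<beta> f) k"
  proof (cases j)
    case 0
    then have "k \<notin> range (\<lambda>(i, j). (i, Suc j))" using k by auto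
    then show ?thesis
      using 0 k by (simp add: ell2_apply_shift2[OF spec[OF assms]] ell2_apply_wreindex_outside[OF inj assms])
  next
    case (Suc n)
    then show ?thesis
      using k ell2_apply_wreindex[OF inj assms, of f "(i, n)"]
      by (simp add: ell2_apply_shift2[OF spec[OF assms]])
  qed
qed

section \<open>Partial translations\<close>

text \<open>The index set \<open>(int \<times> int) \<times> (bool \<times> bool)\<close>, embedded by \<open>\<phi>\<close> into the index type of the larger
  space, indexes four copies of \<open>\<ell>\<^sup>2(\<int>\<^sup>2)\<close>, one for each atom of \<open>{0, 1}\<^sup>2\<close>.\<close>

definition translate :: "((int \<times> int) \<times> (bool \<times> bool) \<Rightarrow> 'k) \<Rightarrow> int \<times> int \<Rightarrow> 'k \<Rightarrow> 'k" where
  "translate \<phi> p k = (if k \<in> range \<phi> then \<phi> (fst (inv \<phi> k) + p, snd (inv \<phi> k)) else k)"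

text \<open>Outside \<open>range \<phi>\<close> the map \<open>translate\<close> is the identity,
  which keeps it injective on the whole index type; the weight 0 makes the operator vanish
  there.\<close>

definition select :: "((int \<times> int) \<times> (bool \<times> bool) \<Rightarrow> 'k) \<Rightarrow> (bool \<times> bool \<Rightarrow> bool) \<Rightarrow> 'k \<Rightarrow> real" where
  "select \<phi> P k = (if k \<in> range \<phi> \<and> P (snd (inv \<phi> k)) then 1 else 0)"

text \<open>A unitary translation on the sheets chosen by \<open>P\<close> and zero elsewhere; in
  Fourier coefficients, multiplication by a monomial. The adjoint only negates \<open>p\<close>, so
  these operators commute with each other and with each other's adjoints.\<close>

definition partial_translation ::
    "((int \<times> int) \<times> (bool \<times> bool) \<Rightarrow> 'k) \<Rightarrow> int \<times> int \<Rightarrow> (bool \<times> bool \<Rightarrow> bool) \<Rightarrow> 'k ell2 \<Rightarrow> 'k ell2" where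
  "partial_translation \<phi> p P = wreindex (translate \<phi> p) (select \<phi> P)"

context
  fixes \<phi> :: "(int \<times> int) \<times> (bool \<times> bool) \<Rightarrow> 'k"
  assumes \<phi>: "inj \<phi>"
begin

lemma translate_simps [simp]: "translate \<phi> p (\<phi> (m, b)) = \<phi> (m + p, b)"
  by (simp add: translate_def inv_f_f[OF \<phi>])

lemma select_simps [simp]: "select \<phi> P (\<phi> (m, b)) = (if P b then 1 else 0)"
  by (simp add: select_def inv_f_f[OF \<phi>])

lemma translate_outside: "k \<notin> range \<phi> \<Longrightarrow> translate \<phi> p k = k"
  by (simp add: translate_def)

lemma index_cases: obtains m b where "k = \<phi> (m, b)" | "k \<notin> range \<phi>"
  by (metis rangeE surj_pair)

lemma translate_translate: "translate \<phi> p (translate \<phi> q k) = translate \<phi> (p + q) k"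
  by (rule index_cases[of k]) (simp_all add: translate_outside add_ac)

lemma translate_zero: "translate \<phi> 0 k = k"
  by (rule index_cases[of k]) (simp_all add: translate_outside)

lemma inj_translate: "inj (translate \<phi> p)"
  by (rule inj_on_inverseI[of _ "translate \<phi> (- p)"]) (simp add: translate_translate translate_zero)

lemma select_translate: "select \<phi> P (translate \<phi> p k) = select \<phi> P k"
  by (rule index_cases[of k]) (simp_all add: translate_outside)

lemma select_bounded: "\<forall>k. \<bar>select \<phi> P k\<bar> \<le> 1"
  by (simp add: select_def)

lemma bounded_op_partial_translation: "bounded_op (partial_translation \<phi> p P)"
  unfolding partial_translation_def by (rule bounded_op_wreindex[OF inj_translate select_bounded])

lemma partial_translation_comp:
  "partial_translation \<phi> p P (partial_translation \<phi> q Q f) =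
     partial_translation \<phi> (p + q) (\<lambda>b. P b \<and> Q b) f"
proof -
  have "translate \<phi> p \<circ> translate \<phi> q = translate \<phi> (p + q)"
    by (simp add: fun_eq_iff translate_translate)
  moreover have "(\<lambda>k. select \<phi> P (translate \<phi> q k) * select \<phi> Q k) = select \<phi> (\<lambda>b. P b \<and> Q b)"
    unfolding select_translate by (auto simp: select_def)
  ultimately show ?thesis
    unfolding partial_translation_def
    by (subst wreindex_wreindex[OF inj_translate select_bounded inj_translate select_bounded]) simp
qed

lemma partial_translation_commute:
  "partial_translation \<phi> p P (partial_translation \<phi> q Q f) =
     partial_translation \<phi> q Q (partial_translation \<phi> p P f)"
  by (simp add: partial_translation_comp add.commute conj_commute)

lemma cinner_partial_translation:
  "cinner (partial_translation \<phi> p P f) g = cinner f (partial_translation \<phi> (- p) P g)"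
proof -
  have "ell2_apply (partial_translation \<phi> (- p) P g) k =
      of_real (select \<phi> P k) * ell2_apply g (translate \<phi> p k)" for k
    using ell2_apply_wreindex[OF inj_translate select_bounded, of "- p" P g "translate \<phi> p k"]
    by (simp add: partial_translation_def translate_translate translate_zero select_translate)
  then show ?thesis
    unfolding partial_translation_def[of _ p] cinner_wreindex_left[OF inj_translate select_bounded]
    unfolding cinner_def by (simp add: mult_ac)
qed

lemma normal_op_partial_translation: "normal_op (partial_translation \<phi> p P)"
proof -
  have "adj (partial_translation \<phi> p P) = partial_translation \<phi> (- p) P"
    by (intro adj_eqI bounded_op_partial_translation cinner_partial_translation)
  then show ?thesis
    by (simp add: normal_op_def bounded_op_partial_translation fun_eq_iff partial_translation_commute)
qed

end

section \<open>Isometric embedding of the quarter lattice into the four sheets\<close>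

definition sheet :: "((int \<times> int) \<times> (bool \<times> bool) \<Rightarrow> 'k) \<Rightarrow> bool \<times> bool \<Rightarrow> nat \<times> nat \<Rightarrow> 'k" where
  "sheet \<phi> b = (\<lambda>(i, j). \<phi> ((int i, int j), b))"

text \<open>The image of \<open>basis_vec k\<close> models a normalized monomial in the space of
  square-integrable functions, with \<open>c b k\<close> as its coefficient on the sheet
  \<open>b\<close>.\<close>

definition sheet_embedding ::
    "((int \<times> int) \<times> (bool \<times> bool) \<Rightarrow> 'k) \<Rightarrow> (bool \<times> bool \<Rightarrow> nat \<times> nat \<Rightarrow> real) \<Rightarrow> (nat \<times> nat) ell2 \<Rightarrow> 'k ell2" where
  "sheet_embedding \<phi> c f = (\<Sum>b\<in>UNIV. wreindex (sheet \<phi> b) (c b) f)"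

context
  fixes \<phi> :: "(int \<times> int) \<times> (bool \<times> bool) \<Rightarrow> 'k" and c :: "bool \<times> bool \<Rightarrow> nat \<times> nat \<Rightarrow> real"
  assumes \<phi>: "inj \<phi>" and c: "\<And>k. (\<Sum>b\<in>UNIV. (c b k)\<^sup>2) = 1"
begin

lemma inj_sheet: "inj (sheet \<phi> b)"
  by (auto simp: inj_on_def sheet_def dest!: injD[OF \<phi>])

lemma sheet_weight_bounded: "\<forall>k. \<bar>c b k\<bar> \<le> 1"
proof
  fix k
  have "(c b k)\<^sup>2 \<le> (\<Sum>b\<in>UNIV. (c b k)\<^sup>2)" by (rule member_le_sum) auto
  then show "\<bar>c b k\<bar> \<le> 1" unfolding c by (simp add: abs_square_le_1)
qed

text \<open>Distinct sheets are orthogonal, so each coordinate \<open>k\<close> is multiplied by the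
  sum of the squared weights, which is 1.\<close>

lemma isometric_sheet_embedding: "isometric_embedding (sheet_embedding \<phi> c)"
  unfolding isometric_embedding_def
proof (intro conjI allI)
  note sheet = inj_sheet sheet_weight_bounded
  show "bounded_op (sheet_embedding \<phi> c)"
    unfolding sheet_embedding_def by (intro bounded_op_sum bounded_op_wreindex[OF sheet])
  fix f g
  have "cinner (wreindex (sheet \<phi> b) (c b) f) (wreindex (sheet \<phi> b') (c b') g) =
      (if b = b' then \<Sum>\<^sub>\<infinity>k. of_real ((c b k)\<^sup>2) * (ell2_apply f k * cnj (ell2_apply g k)) else 0)" for b b'
  proof (cases "b = b'")
    case True
    then show ?thesis
      by (simp add: cinner_wreindex_left[OF sheet] ell2_apply_wreindex[OF sheet] power2_eq_square mult_ac)
  next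
    case False
    then have "sheet \<phi> b k \<notin> range (sheet \<phi> b')" for k
      by (cases k) (auto simp: sheet_def dest!: injD[OF \<phi>])
    with False show ?thesis
      by (simp add: cinner_wreindex_left[OF sheet] ell2_apply_wreindex_outside[OF sheet])
  qed
  then have "cinner (sheet_embedding \<phi> c f) (sheet_embedding \<phi> c g) =
      (\<Sum>b\<in>UNIV. \<Sum>\<^sub>\<infinity>k. of_real ((c b k)\<^sup>2) * (ell2_apply f k * cnj (ell2_apply g k)))"
    by (simp add: sheet_embedding_def cinner_sum_left cinner_sum_right)
  also have "\<dots> = (\<Sum>\<^sub>\<infinity>k. \<Sum>b\<in>UNIV. of_real ((c b k)\<^sup>2) * (ell2_apply f k * cnj (ell2_apply g k)))"
  proof (rule sum_infsum_swap)
    fix b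
    \<comment> \<open>With \<open>id\<close> as the map, \<open>wreindex\<close> is a diagonal
      operator, and the series in question is an inner product of two of its values.\<close>
    have "inj (id :: nat \<times> nat \<Rightarrow> _)" by simp
    note diag = ell2_apply_wreindex[OF this sheet_weight_bounded[of b]]
    show "(\<lambda>k. of_real ((c b k)\<^sup>2) * (ell2_apply f k * cnj (ell2_apply g k))) summable_on UNIV"
      using cinner_summable[of "wreindex id (c b) f" "wreindex id (c b) g"] diag
      by (simp add: power2_eq_square mult_ac)
  qed
  also have "\<dots> = cinner f g"
    unfolding cinner_def sum_distrib_right[symmetric] of_real_sum[symmetric] c by simp
  finally show "cinner (sheet_embedding \<phi> c f) (sheet_embedding \<phi> c g) = cinner f g" .
qed

text \<open>Both sides move index \<open>k\<close> on sheet \<open>b\<close> to \<open>d k\<close>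
  on the same sheet; \<open>weights\<close> states that the accompanying factors agree.\<close>

lemma partial_translation_sheet_embedding:
  assumes d: "inj d" "\<And>i j. d (i, j) = (i + m, j + n)" and \<gamma>: "\<forall>k. \<bar>\<gamma> k\<bar> \<le> C"
    and weights: "\<And>b k. c b (d k) * \<gamma> k = (if P b then c b k else 0)"
  shows "partial_translation \<phi> (int m, int n) P (sheet_embedding \<phi> c f) =
    sheet_embedding \<phi> c (wreindex d \<gamma> f)"
proof -
  note sheet = inj_sheet sheet_weight_bounded
  note pt = inj_translate[OF \<phi>] select_bounded[OF \<phi>]
  have "partial_translation \<phi> (int m, int n) P (wreindex (sheet \<phi> b) (c b) f) =
      wreindex (sheet \<phi> b) (c b) (wreindex d \<gamma> f)" for b
  proof -
    have "translate \<phi> (int m, int n) \<circ> sheet \<phi> b = sheet \<phi> b \<circ> d"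
      by (auto simp: fun_eq_iff sheet_def translate_simps[OF \<phi>] d(2))
    moreover have "(\<lambda>k. select \<phi> P (sheet \<phi> b k) * c b k) = (\<lambda>k. c b (d k) * \<gamma> k)"
      by (auto simp: fun_eq_iff sheet_def select_simps[OF \<phi>] weights)
    ultimately show ?thesis
      unfolding partial_translation_def
      by (simp add: wreindex_wreindex[OF pt sheet] wreindex_wreindex[OF sheet d(1) \<gamma>])
  qed
  moreover have "linear (partial_translation \<phi> (int m, int n) P)"
    using bounded_op_partial_translation[OF \<phi>] by (simp add: bounded_op_def bounded_linear.linear)
  ultimately show ?thesis
    by (simp add: sheet_embedding_def linear_sum)
qed

end


section \<open>The shift \<open>\<langle>x, y, a\<rangle>\<close>\<close>

text \<open>The moments \<open>\<gamma>\<close> of the shift and the masses of its (a priori signed) Berger measure, which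
  lives on \<open>{0, 1}\<^sup>2\<close>.\<close>

definition moment :: "real \<Rightarrow> real \<Rightarrow> real \<Rightarrow> nat \<times> nat \<Rightarrow> real" where
  "moment x y a = (\<lambda>(i, j). if i = 0 then (if j = 0 then 1 else y\<^sup>2) else (if j = 0 then x\<^sup>2 else (a * y)\<^sup>2))"

definition mass :: "real \<Rightarrow> real \<Rightarrow> real \<Rightarrow> bool \<times> bool \<Rightarrow> real" where
  "mass x y a = (\<lambda>(s, t).
     if s then (if t then (a * y)\<^sup>2 else x\<^sup>2 - (a * y)\<^sup>2)
     else (if t then y\<^sup>2 - (a * y)\<^sup>2 else 1 - x\<^sup>2 - y\<^sup>2 + (a * y)\<^sup>2))"

text \<open>The factor \<open>s\<^sup>i t\<^sup>j\<close> at the atom \<open>(s, t)\<close>, with \<open>0\<^sup>0 = 1\<close>, is an indicator.\<close>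

definition sheet_weight :: "real \<Rightarrow> real \<Rightarrow> real \<Rightarrow> bool \<times> bool \<Rightarrow> nat \<times> nat \<Rightarrow> real" where
  "sheet_weight x y a = (\<lambda>(s, t) (i, j).
     if (s \<or> i = 0) \<and> (t \<or> j = 0) then sqrt (mass x y a (s, t)) / sqrt (moment x y a (i, j)) else 0)"

lemma sum_bool_pair: "(\<Sum>b\<in>UNIV. f b) = f (True, True) + f (True, False) + f (False, True) + f (False, False)"
  for f :: "bool \<times> bool \<Rightarrow> real"
  by (simp add: UNIV_Times_UNIV[symmetric] UNIV_bool sum.cartesian_product[symmetric] del: UNIV_Times_UNIV)

context
  fixes x y a :: real
  assumes xya: "0 < x" "x \<le> 1" "0 < y" "y \<le> 1" "0 < a" "a \<le> 1" "a * y \<le> x"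
begin

lemma alpha_xya_bounded: "\<forall>k. \<bar>alpha_xya x a k\<bar> \<le> 1"
  using xya by (auto simp: alpha_xya_def)

lemma beta_xya_bounded: "\<forall>k. \<bar>beta_xya x y a k\<bar> \<le> 1"
  using xya by (auto simp: beta_xya_def)

lemma moment_positive: "0 < moment x y a k"
  using xya by (cases k) (simp add: moment_def)

text \<open>The masses of the atoms at which the monomial of index \<open>k\<close> equals 1 add up
  to the moment at \<open>k\<close>. The assumption makes the mass at the origin nonnegative, so
  that its square root may be squared back.\<close>

lemma sheet_weight_sum_squares:
  assumes "y\<^sup>2 * (1 - a\<^sup>2) \<le> 1 - x\<^sup>2"
  shows "(\<Sum>b\<in>UNIV. (sheet_weight x y a b k)\<^sup>2) = 1"
proof -
  have "(a * y)\<^sup>2 \<le> x\<^sup>2" using xya by (intro power_mono) auto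
  moreover have "(a * y)\<^sup>2 \<le> y\<^sup>2" using xya by (intro power_mono) (auto simp: mult_le_cancel_right1)
  moreover have "0 \<le> 1 - x\<^sup>2 - y\<^sup>2 + (a * y)\<^sup>2" using assms by (simp add: algebra_simps power_mult_distrib)
  ultimately have mass: "0 \<le> mass x y a b" for b
    by (cases b) (auto simp: mass_def)
  have sq: "(sheet_weight x y a (s, t) (i, j))\<^sup>2 =
      (if (s \<or> i = 0) \<and> (t \<or> j = 0) then mass x y a (s, t) / moment x y a (i, j) else 0)" for s t i j
    using mass[of "(s, t)"] moment_positive[of "(i, j)"]
    by (simp add: sheet_weight_def power_divide)
  obtain i j where k: "k = (i, j)" by (cases k)
  show ?thesis
    using xya unfolding k sum_bool_pair sq
    by (cases "i = 0"; cases "j = 0") (auto simp: mass_def moment_def field_simps)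
qed

text \<open>The weight at \<open>k\<close> is the square root of the quotient of consecutive
  moments, so it exchanges their normalizations. Since \<open>Suc i\<close> is never 0, only atoms
  with first coordinate 1 survive.\<close>

lemma sheet_weight_alpha:
  "sheet_weight x y a b (case k of (i, j) \<Rightarrow> (Suc i, j)) * alpha_xya x a k =
    (if fst b then sheet_weight x y a b k else 0)"
proof -
  obtain i j s t where "k = (i, j)" "b = (s, t)" by (cases k, cases b)
  with xya show ?thesis
    by (simp add: sheet_weight_def alpha_xya_def moment_def)
qed

lemma sheet_weight_beta:
  "sheet_weight x y a b (case k of (i, j) \<Rightarrow> (i, Suc j)) * beta_xya x y a k =
    (if snd b then sheet_weight x y a b k else 0)"
proof -
  obtain i j s t where "k = (i, j)" "b = (s, t)" by (cases k, cases b)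
  with xya show ?thesis
    by (simp add: sheet_weight_def beta_xya_def moment_def)
qed

abbreviation "T1 \<equiv> shift1 (alpha_xya x a)"
abbreviation "T2 \<equiv> shift2 (beta_xya x y a)"

lemma bounded_op_T1: "bounded_op T1"
  by (rule bounded_op_shift1[OF spec[OF alpha_xya_bounded]])

lemma bounded_op_T2: "bounded_op T2"
  by (rule bounded_op_shift2[OF spec[OF beta_xya_bounded]])

lemma T1_basis_vec: "T1 (basis_vec (i, j)) = (if i = 0 then if j = 0 then x else a else 1) *\<^sub>R basis_vec (Suc i, j)"
  by (simp add: shift1_basis_vec[OF spec[OF alpha_xya_bounded]]) (simp add: alpha_xya_def)

lemma T2_basis_vec: "T2 (basis_vec (i, j)) = (if j = 0 then if i = 0 then y else a * y / x else 1) *\<^sub>R basis_vec (i, Suc j)"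
  by (simp add: shift2_basis_vec[OF spec[OF beta_xya_bounded]]) (simp add: beta_xya_def)

lemmas T_basis_simps = T1_basis_vec T2_basis_vec bounded_op_scaleR[OF bounded_op_T1]
  bounded_op_scaleR[OF bounded_op_T2]

section \<open>Sufficiency: consequences of the explicit extension\<close>

lemma explicit_normal_extension:
  assumes "y\<^sup>2 * (1 - a\<^sup>2) \<le> 1 - x\<^sup>2"
  obtains \<phi> :: "(int \<times> int) \<times> (bool \<times> bool) \<Rightarrow> 'k::infinite" and V :: "(nat \<times> nat) ell2 \<Rightarrow> 'k ell2"
  where "inj \<phi>" "isometric_embedding V"
    "\<And>f. partial_translation \<phi> (1, 0) fst (V f) = V (T1 f)"
    "\<And>f. partial_translation \<phi> (0, 1) snd (V f) = V (T2 f)"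
proof -
  \<comment> \<open>The index set of the four sheets is countable, so it embeds through the naturals
    into any infinite type.\<close>
  obtain e :: "nat \<Rightarrow> 'k" where "inj e"
    using infinite_countable_subset[OF infinite_UNIV] by blast
  then have \<phi>: "inj (e \<circ> to_nat :: (int \<times> int) \<times> (bool \<times> bool) \<Rightarrow> 'k)"
    by (intro inj_compose) auto
  note c = sheet_weight_sum_squares[OF assms]
  note transl = partial_translation_sheet_embedding[OF \<phi> c]
  show thesis
  proof (rule that[OF \<phi> isometric_sheet_embedding[OF \<phi> c]])
    show "partial_translation (e \<circ> to_nat) (1, 0) fst (sheet_embedding (e \<circ> to_nat) (sheet_weight x y a) f) =
        sheet_embedding (e \<circ> to_nat) (sheet_weight x y a) (T1 f)" for f
      unfolding shift1_eq_wreindex[OF alpha_xya_bounded]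
      using transl[where m = 1 and n = 0 and d = "\<lambda>(i, j). (Suc i, j)" and P = fst,
          OF _ _ alpha_xya_bounded sheet_weight_alpha]
      by (simp add: inj_on_def)
    show "partial_translation (e \<circ> to_nat) (0, 1) snd (sheet_embedding (e \<circ> to_nat) (sheet_weight x y a) f) =
        sheet_embedding (e \<circ> to_nat) (sheet_weight x y a) (T2 f)" for f
      unfolding shift2_eq_wreindex[OF beta_xya_bounded]
      using transl[where m = 0 and n = 1 and d = "\<lambda>(i, j). (i, Suc j)" and P = snd,
          OF _ _ beta_xya_bounded sheet_weight_beta]
      by (simp add: inj_on_def)
  qed
qed

lemma shift_xya_HHinf:
  assumes "y\<^sup>2 * (1 - a\<^sup>2) \<le> 1 - x\<^sup>2"
  shows "shift_xya x y a \<in> HHinf TYPE('k::infinite)"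
proof -
  obtain \<phi> :: "(int \<times> int) \<times> (bool \<times> bool) \<Rightarrow> 'k" and V :: "(nat \<times> nat) ell2 \<Rightarrow> 'k ell2"
    where \<phi>: "inj \<phi>" and V: "isometric_embedding V"
      and T: "\<And>f. partial_translation \<phi> (1, 0) fst (V f) = V (T1 f)"
        "\<And>f. partial_translation \<phi> (0, 1) snd (V f) = V (T2 f)"
    by (rule explicit_normal_extension[OF assms]) blast
  have "subnormal TYPE('k) [T1, T2]"
    unfolding subnormal_def
  proof (intro exI conjI)
    let ?N = "[partial_translation \<phi> (1, 0) fst, partial_translation \<phi> (0, 1) snd]"
    show "isometric_embedding V" by (rule V)
    show "length ?N = length [T1, T2]" by simp
    show "\<forall>i<length [T1, T2]. normal_op (?N ! i)"
      by (auto simp: less_Suc_eq normal_op_partial_translation[OF \<phi>])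
    show "\<forall>i<length [T1, T2]. \<forall>j<length [T1, T2]. ?N ! i \<circ> ?N ! j = ?N ! j \<circ> ?N ! i"
      by (auto simp: less_Suc_eq fun_eq_iff intro: partial_translation_commute[OF \<phi>])
    show "\<forall>i<length [T1, T2]. ?N ! i \<circ> V = V \<circ> [T1, T2] ! i"
      by (auto simp: less_Suc_eq fun_eq_iff T)
  qed
  then show ?thesis
    by (simp add: shift_xya_def weighted_shift_def HHinf_def bounded_op_T1 bounded_op_T2)
qed

lemma bounded_ops_5:
  "i < length [T1, T2, T1 \<circ> T1, T2 \<circ> T1, T2 \<circ> T2] \<Longrightarrow>
    bounded_op ([T1, T2, T1 \<circ> T1, T2 \<circ> T1, T2 \<circ> T2] ! i)"
  by (auto simp: less_Suc_eq bounded_op_T1 bounded_op_T2 bounded_op_comp)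

lemma hyponormal_5:
  assumes "y\<^sup>2 * (1 - a\<^sup>2) \<le> 1 - x\<^sup>2"
  shows "hyponormal [T1, T2, T1 \<circ> T1, T2 \<circ> T1, T2 \<circ> T2]" (is "hyponormal ?S")
proof -
  \<comment> \<open>Hyponormality does not mention the larger space, so the extension may be taken
    over the index type \<open>nat\<close>.\<close>
  obtain \<phi> :: "(int \<times> int) \<times> (bool \<times> bool) \<Rightarrow> nat" and V :: "(nat \<times> nat) ell2 \<Rightarrow> nat ell2"
    where \<phi>: "inj \<phi>" and V: "isometric_embedding V"
      and T: "\<And>f. partial_translation \<phi> (1, 0) fst (V f) = V (T1 f)"
        "\<And>f. partial_translation \<phi> (0, 1) snd (V f) = V (T2 f)"
    by (rule explicit_normal_extension[OF assms]) blast
  \<comment> \<open>Exponents and selections of the five words, left as sums and conjunctions in the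
    shape that \<open>partial_translation_comp\<close> produces.\<close>
  let ?p = "[(1, 0), (0, 1), (1, 0) + (1, 0), (0, 1) + (1, 0), (0, 1) + (0, 1)] :: (int \<times> int) list"
  let ?P = "[fst, snd, \<lambda>b. fst b \<and> fst b, \<lambda>b. snd b \<and> fst b, \<lambda>b. snd b \<and> snd b] :: (bool \<times> bool \<Rightarrow> bool) list"
  show ?thesis
  proof (rule hyponormal_if_doubly_commuting_extension[OF V, where
        M = "\<lambda>i. partial_translation \<phi> (?p ! i) (?P ! i)" and
        A = "\<lambda>i. partial_translation \<phi> (- (?p ! i)) (?P ! i)"])
    fix i f assume "i < length ?S"
    then have "i = 0 \<or> i = 1 \<or> i = 2 \<or> i = 3 \<or> i = 4" by auto
    then show "partial_translation \<phi> (?p ! i) (?P ! i) (V f) = V ((?S ! i) f)"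
      by (elim disjE; hypsubst)
         (simp_all add: partial_translation_comp[OF \<phi>] conj_commute flip: T)
  qed (rule bounded_ops_5 cinner_partial_translation[OF \<phi>] partial_translation_commute[OF \<phi>]; assumption?)+
qed

section \<open>Necessity: the mass at the origin is nonnegative\<close>

lemma mass_nonneg_if_HHinf:
  assumes "shift_xya x y a \<in> HHinf TYPE('k::infinite)"
  shows "0 \<le> 1 - x\<^sup>2 - y\<^sup>2 + (a * y)\<^sup>2"
proof -
  from assms obtain V :: "(nat \<times> nat) ell2 \<Rightarrow> 'k ell2" and N
    where V: "isometric_embedding V"
      and normal: "\<forall>i<length [T1, T2]. normal_op (N ! i)"
      and comm: "\<forall>i<length [T1, T2]. \<forall>j<length [T1, T2]. N ! i \<circ> N ! j = N ! j \<circ> N ! i"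
      and ext: "\<forall>i<length [T1, T2]. N ! i \<circ> V = V \<circ> [T1, T2] ! i"
    by (auto simp: shift_xya_def weighted_shift_def HHinf_def subnormal_def)
  have N: "(N ! 0) (V f) = V (T1 f)" "(N ! Suc 0) (V f) = V (T2 f)" for f
    using ext by (auto simp: fun_eq_iff)
  have V_norm: "norm (V f) = norm f" for f
    using V by (simp add: isometric_embedding_def norm_ell2_def inner_ell2_def)
  \<comment> \<open>The squared norms of the iterates of this vector are the moments. These depend
    only on which indices vanish, which yields all the required norm equalities.\<close>
  have "0 \<le> (norm (V (basis_vec (0, 0))))\<^sup>2 - (norm ((N ! 0) (V (basis_vec (0, 0)))))\<^sup>2
      - (norm ((N ! Suc 0) (V (basis_vec (0, 0)))))\<^sup>2 + (norm ((N ! 0) ((N ! Suc 0) (V (basis_vec (0, 0))))))\<^sup>2"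
    by (rule commuting_normal_pair_inequality)
       (use normal comm in \<open>simp_all add: N V_norm T_basis_simps\<close>)
  then show ?thesis
    using xya by (simp add: N V_norm T_basis_simps abs_mult mult.commute)
qed

lemma mass_nonneg_if_hyponormal_5:
  assumes "hyponormal [T1, T2, T1 \<circ> T1, T2 \<circ> T1, T2 \<circ> T2]"
  shows "0 \<le> 1 - x\<^sup>2 - y\<^sup>2 + (a * y)\<^sup>2"
proof -
  \<comment> \<open>the coefficients of \<open>(1 - s)(1 - t) = 1 - s - t + 0 s\<^sup>2 + s t + 0 t\<^sup>2\<close>, which is the indicator
    of the atom \<open>(0, 0)\<close>, each scaled by the square root of the corresponding moment\<close>
  let ?h = "\<lambda>j. [(- x) *\<^sub>R basis_vec (1, 0), (- y) *\<^sub>R basis_vec (0, 1), 0,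
    (a * y) *\<^sub>R basis_vec (1, 1), 0] ! j"
  have zero: "T1 0 = 0" "T2 0 = 0"
    using bounded_op_diff[OF bounded_op_T1, of 0 0] bounded_op_diff[OF bounded_op_T2, of 0 0] by simp_all
  show ?thesis
    \<comment> \<open>The vector \<open>basis_vec (0, 0)\<close> supplies the constant coefficient
      1, and the form evaluates to the mass at the origin.\<close>
    using hyponormal_form_nonneg[OF bounded_ops_5 assms, of "basis_vec (0, 0)" ?h] xya
    by (simp add: lessThan_Suc zero T_basis_simps cinner_scaleR_left cinner_scaleR_right
        cinner_basis_vec power2_eq_square algebra_simps del: scaleR_minus_left)
qed

end

theorem corollary6p3:
  fixes x y a :: real
  assumes "0 < x" "x \<le> 1" "0 < y" "y \<le> 1" "0 < a" "a \<le> 1" "a * y \<le> x"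
    and "shift_xya x y a \<in> HH1 TYPE('k::infinite)"
  shows "(shift_xya x y a \<in> HH2 TYPE('k) \<longleftrightarrow> shift_xya x y a \<in> HHinf TYPE('k)) \<and>
         (shift_xya x y a \<in> HHinf TYPE('k) \<longleftrightarrow>
            (if a = 1 then y\<^sup>2 * (1 - a\<^sup>2) \<le> 1 - x\<^sup>2
             else y \<le> sqrt ((1 - x\<^sup>2) / (1 - a\<^sup>2))))"
proof -
  note xya = assms(1-7)
  let ?iii = "y\<^sup>2 * (1 - a\<^sup>2) \<le> 1 - x\<^sup>2"
  have mass: "0 \<le> 1 - x\<^sup>2 - y\<^sup>2 + (a * y)\<^sup>2 \<longleftrightarrow> ?iii"
    by (simp add: algebra_simps power_mult_distrib)
  have inf: "shift_xya x y a \<in> HHinf TYPE('k) \<longleftrightarrow> ?iii"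
    using mass_nonneg_if_HHinf[OF xya, where 'k = 'k] shift_xya_HHinf[OF xya, where 'k = 'k] mass by blast
  \<comment> \<open>Membership in \<open>HH0\<close> comes from the assumption on
    \<open>HH1\<close>, leaving only hyponormality of the five words to decide.\<close>
  have two: "shift_xya x y a \<in> HH2 TYPE('k) \<longleftrightarrow> ?iii"
    using assms(8) mass_nonneg_if_hyponormal_5[OF xya] hyponormal_5[OF xya] mass
    unfolding HH1_def HH2_def shift_xya_def weighted_shift_def by auto
  have "?iii \<longleftrightarrow> y \<le> sqrt ((1 - x\<^sup>2) / (1 - a\<^sup>2))" if "a \<noteq> 1"
  proof -
    have "0 < 1 - a\<^sup>2" using that xya by (simp add: power_less_one_iff)
    moreover have "y \<le> sqrt ((1 - x\<^sup>2) / (1 - a\<^sup>2)) \<longleftrightarrow> y\<^sup>2 \<le> (1 - x\<^sup>2) / (1 - a\<^sup>2)"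
      using xya by (metis less_imp_le real_le_lsqrt real_le_rsqrt real_sqrt_le_iff real_sqrt_unique)
    ultimately show ?thesis by (simp add: pos_le_divide_eq)
  qed
  with inf two show ?thesis by simp
qed

end
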